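(* \[ C_U=\bigcap_{\mathbb{Q}\in\widehat{M}_V}\overline{K_U}^{L^1(\mathbb{Q})}=\bigcap_{\mathbb{Q}\in\widehat{M}_V}\overline{K-L^1_+(\mathbb{Q})}^{L^1(\mathbb{Q})}, \] where $\overline{A}^{L^1(\mathbb{Q})}$ denotes the closure of $A$ in the norm topology of $L^1(\mathbb{Q})$.
   Context: Let $(\Omega,\mathcal{F},\mathbb{P})$ be a probability space and $K\subseteq L^0(\mathbb{P})$ a convex cone (of terminal wealths). Let $a\in[-\infty,\infty)$ and $U:(a,\infty)\to\mathbb{R}$ be increasing, strictly concave, continuously differentiable with $\lim_{x\downarrow a}U'(x)=\infty$ and $\lim_{x\uparrow\infty}U'(x)=0$; if $a=-\infty$, assume moreover $\liminf_{x\to-\infty}\frac{xU'(x)}{U(x)}>1$. Let $V(y)=\sup_{x\in(a,\infty)}\{U(x)-xy\}$ for $y>0$ and $V^+=\max\{V,0\}$. Define $M_1=\{\mathbb{Q}\ll\mathbb{P}: X\in L^1(\mathbb{Q})\text{ and }\mathbb{E}_{\mathbb{Q}}[X]\le 0\text{ for all }X\in K\}$. A measure $\mathbb{Q}\ll\mathbb{P}$ has finite loss-entropy if there is $b>0$ with $\mathbb{E}_{\mathbb{P}}\big[V^+\big(\tfrac{d\mathbb{Q}}{d\mathbb{P}}\big)\mathbf{1}_{\{d\mathbb{Q}/d\mathbb{P}\ge b\}}\big]<\infty$; $\widehat{M}_V=\{\mathbb{Q}\in M_1:\mathbb{Q}\text{ has finite loss-entropy}\}$. Let $L_U=\bigcap_{\mathbb{Q}\in\widehat{M}_V}L^1(\mathbb{Q})$,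 let $L_V^+\subseteq L^1(\mathbb{P})$ be the linear span of the densities $d\mathbb{Q}/d\mathbb{P}$, $\mathbb{Q}\in\widehat{M}_V$, paired with $L_U$ via $\langle X,X^+\rangle=\mathbb{E}_{\mathbb{P}}[XX^+]$. Let $K_U=\{X\in L_U: X\le\widetilde X\text{ for some }\widetilde X\in K\}$ and $C_U$ the closure of $K_U$ in the weak topology $\sigma(L_U,L_V^+)$. Here $K-L^1_+(\mathbb{Q})=\{X-Y: X\in K,\ Y\in L^1_+(\mathbb{Q})\}$. *)

theory Defs
  imports "HOL-Probability.Probability"
begin

definition dom_U :: "ereal \<Rightarrow> real set" where
  "dom_U a = {x. a < ereal x}"

definition strictly_concave_on :: "real set \<Rightarrow> (real \<Rightarrow> real) \<Rightarrow> bool" where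
  "strictly_concave_on S f \<longleftrightarrow>
     (\<forall>x\<in>S. \<forall>y\<in>S. \<forall>t::real. x \<noteq> y \<and> 0 < t \<and> t < 1 \<longrightarrow>
        (1 - t) * f x + t * f y < f ((1 - t) * x + t * y))"

definition at_left_end :: "ereal \<Rightarrow> real filter" where
  "at_left_end a = (if a = -\<infinity> then at_bot else at_right (real_of_ereal a))"

definition utility :: "ereal \<Rightarrow> (real \<Rightarrow> real) \<Rightarrow> (real \<Rightarrow> real) \<Rightarrow> bool" where
  "utility a U U' \<longleftrightarrow>
     a < \<infinity> \<and>
     mono_on (dom_U a) U \<and>
     strictly_concave_on (dom_U a) U \<and>
     (\<forall>x\<in>dom_U a. (U has_real_derivative U' x) (at x)) \<and>
     continuous_on (dom_U a) U' \<and>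
     filterlim U' at_top (at_left_end a) \<and>
     (U' \<longlongrightarrow> 0) at_top \<and>
     (a = -\<infinity> \<longrightarrow> Liminf at_bot (\<lambda>x. ereal (x * U' x / U x)) > 1)"

definition conj_V :: "ereal \<Rightarrow> (real \<Rightarrow> real) \<Rightarrow> real \<Rightarrow> real" where
  "conj_V a U y = (SUP x\<in>dom_U a. U x - x * y)"

definition conj_V_plus :: "ereal \<Rightarrow> (real \<Rightarrow> real) \<Rightarrow> real \<Rightarrow> real" where
  "conj_V_plus a U y = max (conj_V a U y) 0"

definition convex_cone_rv :: "('w \<Rightarrow> real) set \<Rightarrow> bool" where
  "convex_cone_rv K \<longleftrightarrow>
     (\<forall>X\<in>K. \<forall>Y\<in>K. \<forall>s::real. \<forall>t::real. 0 \<le> s \<and> 0 \<le> t \<longrightarrow> (\<lambda>w. s * X w + t * Y w) \<in> K)"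

definition dens :: "'w measure \<Rightarrow> 'w measure \<Rightarrow> 'w \<Rightarrow> real" where
  "dens P Q = (\<lambda>w. enn2real (RN_deriv P Q w))"

definition M1 :: "'w measure \<Rightarrow> ('w \<Rightarrow> real) set \<Rightarrow> 'w measure set" where
  "M1 P K = {Q. sets Q = sets P \<and> prob_space Q \<and> absolutely_continuous P Q \<and>
               (\<forall>X\<in>K. integrable Q X \<and> integral\<^sup>L Q X \<le> 0)}"

definition finite_loss_entropy :: "ereal \<Rightarrow> (real \<Rightarrow> real) \<Rightarrow> 'w measure \<Rightarrow> 'w measure \<Rightarrow> bool" where
  "finite_loss_entropy a U P Q \<longleftrightarrow>
     (\<exists>b>0. (\<integral>\<^sup>+ w. ennreal (conj_V_plus a U (dens P Q w) *
                               indicator {w. dens P Q w \<ge> b} w) \<partial>P) < \<infinity>)"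

definition M_V_hat :: "ereal \<Rightarrow> (real \<Rightarrow> real) \<Rightarrow> 'w measure \<Rightarrow> ('w \<Rightarrow> real) set \<Rightarrow> 'w measure set" where
  "M_V_hat a U P K = {Q \<in> M1 P K. finite_loss_entropy a U P Q}"

definition L_U :: "ereal \<Rightarrow> (real \<Rightarrow> real) \<Rightarrow> 'w measure \<Rightarrow> ('w \<Rightarrow> real) set \<Rightarrow> ('w \<Rightarrow> real) set" where
  "L_U a U P K = {X \<in> borel_measurable P. \<forall>Q\<in>M_V_hat a U P K. integrable Q X}"

definition L_V_plus :: "ereal \<Rightarrow> (real \<Rightarrow> real) \<Rightarrow> 'w measure \<Rightarrow> ('w \<Rightarrow> real) set \<Rightarrow> ('w \<Rightarrow> real) set" where
  "L_V_plus a U P K =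
     {(\<lambda>w. \<Sum>i<n. c i * dens P (Qs i) w) | (n::nat) c Qs. \<forall>i<n. Qs i \<in> M_V_hat a U P K}"

definition weak_top :: "ereal \<Rightarrow> (real \<Rightarrow> real) \<Rightarrow> 'w measure \<Rightarrow> ('w \<Rightarrow> real) set \<Rightarrow> ('w \<Rightarrow> real) topology" where
  "weak_top a U P K = topology_generated_by
     {{X \<in> L_U a U P K. (\<integral>w. X w * Y w \<partial>P) \<in> G} | Y G. Y \<in> L_V_plus a U P K \<and> open G}"

definition K_U :: "ereal \<Rightarrow> (real \<Rightarrow> real) \<Rightarrow> 'w measure \<Rightarrow> ('w \<Rightarrow> real) set \<Rightarrow> ('w \<Rightarrow> real) set" where
  "K_U a U P K = {X \<in> L_U a U P K. \<exists>X'\<in>K. AE w in P. X w \<le> X' w}"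

definition C_U :: "ereal \<Rightarrow> (real \<Rightarrow> real) \<Rightarrow> 'w measure \<Rightarrow> ('w \<Rightarrow> real) set \<Rightarrow> ('w \<Rightarrow> real) set" where
  "C_U a U P K = (weak_top a U P K) closure_of (K_U a U P K)"

definition L1_closure :: "'w measure \<Rightarrow> ('w \<Rightarrow> real) set \<Rightarrow> ('w \<Rightarrow> real) set" where
  "L1_closure Q A = {X. integrable Q X \<and>
     (\<forall>e>0. \<exists>Z\<in>A. integrable Q Z \<and> (\<integral>w. \<bar>Z w - X w\<bar> \<partial>Q) < e)}"

definition K_minus_L1plus :: "'w measure \<Rightarrow> ('w \<Rightarrow> real) set \<Rightarrow> ('w \<Rightarrow> real) set" where
  "K_minus_L1plus Q K = {(\<lambda>w. X w - Y w) | X Y. X \<in> K \<and> integrable Q Y \<and> (AE w in Q. 0 \<le> Y w)}"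

end

theory Submission
  imports Defs
begin

text \<open>All three sets consist of those \<open>X \<in> L\<^sub>U\<close> for which \<open>E\<^sub>Q[(X - k)\<^sup>+]\<close> becomes arbitrarily small
  over \<open>k \<in> K\<close>, for every \<open>Q\<close> with finite loss-entropy in \<open>M\<^sub>1\<close>. For the two
  \<open>L\<^sup>1\<close>-closures the approximating elements are \<open>min X k\<close>. A weak neighbourhood involves finitely many
  measures, and these are dominated by their mixture, which again has finite loss-entropy; hence
  such an \<open>X\<close> lies in \<open>C\<^sub>U\<close>. Conversely, if \<open>E\<^sub>Q[(X - k)\<^sup>+]\<close> is bounded away from \<open>0\<close>,
  then Hahn-Banach for the sublinear functional \<open>Y \<mapsto> inf\<^sub>k E\<^sub>Q[(Y - k)\<^sup>+]\<close> yields a bounded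
  density \<open>Z \<ge> 0\<close> with \<open>E\<^sub>Q[Z k] \<le> 0 < E\<^sub>Q[Z X]\<close>. The growth bound
  \<open>V (l y) \<le> A V\<^sup>+ (y) + B y\<close>, which is where the condition on \<open>x U'(x) / U(x)\<close> at \<open>-\<infinity>\<close> enters,
  shows that the measure with density \<open>Z\<close> has finite loss-entropy, so it separates \<open>X\<close>
  weakly from \<open>K\<^sub>U\<close>.\<close>

section \<open>Sublinear functionals on spaces of functions\<close>

text \<open>Linear subspaces of actual functions: Hahn-Banach is applied below to the functions
  integrable for one measure, without passing to classes modulo null sets.\<close>

definition function_space :: "('w \<Rightarrow> real) set \<Rightarrow> bool" where
  "function_space S \<longleftrightarrow> S \<noteq> {} \<and>
     (\<forall>x\<in>S. \<forall>y\<in>S. (\<lambda>w. x w + y w) \<in> S) \<and> (\<forall>x\<in>S. \<forall>t. (\<lambda>w. t * x w) \<in> S)"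

text \<open>Homogeneity is only an inequality for positive factors, which is easy to check for
  infima; scaling back by \<open>1/t\<close> turns it into equality in
  \<open>sublinear_on_scale\<close>.\<close>

definition sublinear_on :: "('w \<Rightarrow> real) set \<Rightarrow> (('w \<Rightarrow> real) \<Rightarrow> real) \<Rightarrow> bool" where
  "sublinear_on S p \<longleftrightarrow>
     (\<forall>x\<in>S. \<forall>y\<in>S. p (\<lambda>w. x w + y w) \<le> p x + p y) \<and>
     (\<forall>x\<in>S. \<forall>t>0. p (\<lambda>w. t * x w) \<le> t * p x)"

lemma function_spaceD:
  assumes "function_space S"
  shows "(\<lambda>w. 0) \<in> S"
    and "x \<in> S \<Longrightarrow> y \<in> S \<Longrightarrow> (\<lambda>w. x w + y w) \<in> S"
    and "x \<in> S \<Longrightarrow> (\<lambda>w. t * x w) \<in> S"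
    and "x \<in> S \<Longrightarrow> (\<lambda>w. - x w) \<in> S"
proof -
  obtain z where "z \<in> S" using assms by (auto simp: function_space_def)
  then have "(\<lambda>w. 0 * z w) \<in> S" using assms unfolding function_space_def by blast
  then show "(\<lambda>w. 0) \<in> S" by simp
  show "x \<in> S \<Longrightarrow> y \<in> S \<Longrightarrow> (\<lambda>w. x w + y w) \<in> S"
    and sc: "x \<in> S \<Longrightarrow> (\<lambda>w. t * x w) \<in> S" for t
    using assms by (auto simp: function_space_def)
  show "x \<in> S \<Longrightarrow> (\<lambda>w. - x w) \<in> S" using sc[of "-1"] by simp
qed

lemma sublinear_on_add:
  "sublinear_on S p \<Longrightarrow> x \<in> S \<Longrightarrow> y \<in> S \<Longrightarrow> p (\<lambda>w. x w + y w) \<le> p x + p y"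
  by (simp add: sublinear_on_def)

lemma sublinear_on_zero:
  assumes "function_space S" "sublinear_on S p"
  shows "p (\<lambda>w. 0) = 0"
proof -
  have *: "p (\<lambda>w. 0) \<le> t * p (\<lambda>w. 0)" if "t > 0" for t
    using assms(2) function_spaceD(1)[OF assms(1)] that unfolding sublinear_on_def by force
  \<comment> \<open>The factor 2 gives \<open>0 \<le> p 0\<close>, the factor 1/2 gives
    \<open>p 0 \<le> 0\<close>.\<close>
  show ?thesis using *[of 2] *[of "1/2"] by simp
qed

lemma sublinear_on_scale:
  assumes S: "function_space S" and p: "sublinear_on S p" and x: "x \<in> S" and t: "t \<ge> 0"
  shows "p (\<lambda>w. t * x w) = t * p x"
proof (cases "t = 0")
  case True
  then show ?thesis using sublinear_on_zero[OF S p] by simp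
next
  case False
  with t have t: "t > 0" by simp
  have *: "p (\<lambda>w. s * y w) \<le> s * p y" if "y \<in> S" "s > 0" for y s
    using p that unfolding sublinear_on_def by blast
  have "p (\<lambda>w. (1/t) * (t * x w)) \<le> (1/t) * p (\<lambda>w. t * x w)"
    by (rule *) (use function_spaceD(3)[OF S x, of t] t in simp_all)
  then have "t * p x \<le> p (\<lambda>w. t * x w)" using t by (simp add: field_simps)
  moreover have "p (\<lambda>w. t * x w) \<le> t * p x" by (rule *[OF x t])
  ultimately show ?thesis by simp
qed

lemma sublinear_on_minus:
  assumes S: "function_space S" and p: "sublinear_on S p" and x: "x \<in> S"
  shows "- p (\<lambda>w. - x w) \<le> p x"
  using sublinear_on_add[OF p x function_spaceD(4)[OF S x]] sublinear_on_zero[OF S p] by simp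

text \<open>The classical auxiliary functional for Hahn-Banach: it lies below \<open>q\<close>, and
  \<open>t = 1\<close> bounds its value at \<open>-v\<close> by \<open>- q v\<close>, so it is
  linear along \<open>v\<close>. If it coincides with \<open>q\<close> for every \<open>v\<close>,
  then \<open>q\<close> is additive.\<close>

definition sublinear_shift :: "(('w \<Rightarrow> real) \<Rightarrow> real) \<Rightarrow> ('w \<Rightarrow> real) \<Rightarrow> ('w \<Rightarrow> real) \<Rightarrow> real" where
  "sublinear_shift q v x = (INF t\<in>{0..}. q (\<lambda>w. x w + t * v w) - t * q v)"

context
  fixes S :: "('w \<Rightarrow> real) set" and q v
  assumes S: "function_space S" and q: "sublinear_on S q" and v: "v \<in> S"
begin

lemma sublinear_shift_le:
  assumes x: "x \<in> S" and t: "t \<ge> 0"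
  shows "sublinear_shift q v x \<le> q (\<lambda>w. x w + t * v w) - t * q v"
  unfolding sublinear_shift_def
proof (rule cINF_lower)
  show "bdd_below ((\<lambda>t. q (\<lambda>w. x w + t * v w) - t * q v) ` {0..})"
  proof (rule bdd_belowI2)
    fix s :: real assume s: "s \<in> {0..}"
    \<comment> \<open>Writing \<open>s * v\<close> as \<open>(x + s * v) + (- x)\<close> yields the
      lower bound \<open>- q (- x)\<close>, uniform in \<open>s\<close>.\<close>
    have "q (\<lambda>w. (x w + s * v w) + - x w) \<le> q (\<lambda>w. x w + s * v w) + q (\<lambda>w. - x w)"
      by (intro sublinear_on_add[OF q] function_spaceD[OF S] x v)
    then show "- q (\<lambda>w. - x w) \<le> q (\<lambda>w. x w + s * v w) - s * q v"
      using sublinear_on_scale[OF S q v, of s] s by simp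
  qed
qed (use t in simp)

lemma sublinear_shift_greatest:
  assumes "\<And>t. t \<ge> 0 \<Longrightarrow> c \<le> q (\<lambda>w. x w + t * v w) - t * q v"
  shows "c \<le> sublinear_shift q v x"
  unfolding sublinear_shift_def by (rule cINF_greatest) (use assms in auto)

text \<open>Parameters \<open>s\<close> for \<open>x\<close> and \<open>t\<close> for
  \<open>y\<close> combine to \<open>s + t\<close> for \<open>x + y\<close>; a parameter
  \<open>t\<close> for \<open>x\<close> becomes \<open>c * t\<close> for \<open>c * x\<close>. The
  two infima on the right are then taken one after the other.\<close>

lemma sublinear_on_shift: "sublinear_on S (sublinear_shift q v)"
  unfolding sublinear_on_def
proof (intro conjI ballI allI impI)
  fix x y assume x: "x \<in> S" and y: "y \<in> S"
  have *: "sublinear_shift q v (\<lambda>w. x w + y w)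
      \<le> (q (\<lambda>w. x w + s * v w) - s * q v) + (q (\<lambda>w. y w + t * v w) - t * q v)"
    if "s \<ge> 0" "t \<ge> 0" for s t
  proof -
    have "sublinear_shift q v (\<lambda>w. x w + y w) \<le> q (\<lambda>w. (x w + y w) + (s + t) * v w) - (s + t) * q v"
      using that by (intro sublinear_shift_le function_spaceD[OF S] x y) auto
    also have "(\<lambda>w. (x w + y w) + (s + t) * v w) = (\<lambda>w. (x w + s * v w) + (y w + t * v w))"
      by (auto simp: algebra_simps)
    also have "q \<dots> \<le> q (\<lambda>w. x w + s * v w) + q (\<lambda>w. y w + t * v w)"
      by (intro sublinear_on_add[OF q] function_spaceD[OF S] x y v)
    finally show ?thesis by (simp add: algebra_simps)
  qed
  have "sublinear_shift q v (\<lambda>w. x w + y w) - (q (\<lambda>w. y w + t * v w) - t * q v) \<le> sublinear_shift q v x"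
    if "t \<ge> 0" for t
    by (rule sublinear_shift_greatest) (use *[OF _ that] in force)
  then have "sublinear_shift q v (\<lambda>w. x w + y w) - sublinear_shift q v x \<le> sublinear_shift q v y"
    by (intro sublinear_shift_greatest) force
  then show "sublinear_shift q v (\<lambda>w. x w + y w) \<le> sublinear_shift q v x + sublinear_shift q v y" by simp
next
  fix x and c :: real assume x: "x \<in> S" and c: "0 < c"
  have "sublinear_shift q v (\<lambda>w. c * x w) / c \<le> sublinear_shift q v x"
  proof (rule sublinear_shift_greatest)
    fix t :: real assume t: "t \<ge> 0"
    have "sublinear_shift q v (\<lambda>w. c * x w) \<le> q (\<lambda>w. c * x w + (c * t) * v w) - (c * t) * q v"
      using t c by (intro sublinear_shift_le function_spaceD[OF S] x) auto
    also have "(\<lambda>w. c * x w + (c * t) * v w) = (\<lambda>w. c * (x w + t * v w))"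
      by (auto simp: algebra_simps)
    also have "q \<dots> = c * q (\<lambda>w. x w + t * v w)"
      using c by (intro sublinear_on_scale[OF S q] function_spaceD[OF S] x v) auto
    finally show "sublinear_shift q v (\<lambda>w. c * x w) / c \<le> q (\<lambda>w. x w + t * v w) - t * q v"
      using c by (simp add: field_simps)
  qed
  then show "sublinear_shift q v (\<lambda>w. c * x w) \<le> c * sublinear_shift q v x" using c by (simp add: field_simps)
qed

end

text \<open>Zorn's lemma, with the pointwise infimum as the bound of a chain. Minimality replaces
  the usual step-by-step extension of a functional from a subspace.\<close>

lemma exists_minimal_sublinear:
  assumes S: "function_space S" and p: "sublinear_on S p"
  obtains q where "sublinear_on S q" "\<And>x. x \<in> S \<Longrightarrow> q x \<le> p x"
    "\<And>r x. sublinear_on S r \<Longrightarrow> (\<And>x. x \<in> S \<Longrightarrow> r x \<le> q x) \<Longrightarrow> x \<in> S \<Longrightarrow> r x = q x"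
proof -
  \<comment> \<open>Values outside \<open>S\<close> are fixed to 0, so that agreement on
    \<open>S\<close> is equality of functions and the order on \<open>F\<close> is
    antisymmetric.\<close>
  define F where "F = {q. sublinear_on S q \<and> (\<forall>x\<in>S. q x \<le> p x) \<and> (\<forall>x. x \<notin> S \<longrightarrow> q x = 0)}"
  \<comment> \<open>The order is reversed: a maximal element for \<open>R\<close> is a minimal
    functional.\<close>
  define R where "R = (\<lambda>q r :: ('a \<Rightarrow> real) \<Rightarrow> real. r \<le> q)"
  have restr: "sublinear_on S (\<lambda>x. if x \<in> S then r x else 0)" if "sublinear_on S r" for r
    using that function_spaceD[OF S] unfolding sublinear_on_def by auto
  have "\<exists>m\<in>F. \<forall>a\<in>F. R m a \<longrightarrow> a = m"
  proof (rule predicate_Zorn)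
    show "partial_order_on F (relation_of R F)"
      by (rule partial_order_on_relation_ofI) (auto simp: R_def)
  next
    fix C assume C: "C \<in> Chains (relation_of R F)"
    have CF: "C \<subseteq> F" using C by (auto simp: Chains_def relation_of_def)
    have tot: "a \<le> b \<or> b \<le> a" if "a \<in> C" "b \<in> C" for a b
      using C that by (auto simp: Chains_def relation_of_def R_def)
    show "\<exists>u\<in>F. \<forall>a\<in>C. R a u"
    proof (cases "C = {}")
      case True
      have "(\<lambda>x. if x \<in> S then p x else 0) \<in> F"
        using restr[OF p] by (auto simp: F_def)
      with True show ?thesis by blast
    next
      case False
      define u where "u x = (INF q\<in>C. q x)" for x
      \<comment> \<open>Every member satisfies \<open>q x \<ge> - q (- x) \<ge> - p (- x)\<close>,
        so the infimum over the chain is a real number.\<close>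
      have bdd: "bdd_below ((\<lambda>q. q x) ` C)" for x
      proof (cases "x \<in> S")
        case True
        show ?thesis
        proof (rule bdd_belowI2)
          fix q assume "q \<in> C"
          then have "q \<in> F" using CF by auto
          then have "sublinear_on S q" "q (\<lambda>w. - x w) \<le> p (\<lambda>w. - x w)"
            using function_spaceD(4)[OF S True] by (auto simp: F_def)
          then show "- p (\<lambda>w. - x w) \<le> q x" using sublinear_on_minus[OF S _ True, of q] by linarith
        qed
      next
        case False
        then show ?thesis using CF by (intro bdd_belowI2[of _ 0]) (auto simp: F_def)
      qed
      have low: "u x \<le> q x" if "q \<in> C" for q x
        unfolding u_def by (rule cINF_lower[OF bdd that])
      have great: "c \<le> u x" if "\<And>q. q \<in> C \<Longrightarrow> c \<le> q x" for c x
        unfolding u_def by (rule cINF_greatest[OF False that])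
      obtain q0 where q0: "q0 \<in> C" using False by auto
      have sub: "sublinear_on S q" if "q \<in> C" for q using CF that by (auto simp: F_def)
      have "sublinear_on S u"
        unfolding sublinear_on_def
      proof (intro conjI ballI allI impI)
        fix x y assume x: "x \<in> S" and y: "y \<in> S"
        \<comment> \<open>Two members of a chain are comparable, and subadditivity of the smaller
          one bounds both summands.\<close>
        have *: "u (\<lambda>w. x w + y w) \<le> q x + r y" if q: "q \<in> C" and r: "r \<in> C" for q r
        proof (cases "q \<le> r")
          case True
          then show ?thesis using low[OF q, of "\<lambda>w. x w + y w"] sublinear_on_add[OF sub[OF q] x y]
              le_funD[OF True, of y] by linarith
        next
          case False
          then have "r \<le> q" using tot[OF q r] by auto
          then show ?thesis using low[OF r, of "\<lambda>w. x w + y w"] sublinear_on_add[OF sub[OF r] x y]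
              le_funD[of r q x] by linarith
        qed
        have "u (\<lambda>w. x w + y w) - r y \<le> u x" if "r \<in> C" for r
          by (rule great) (use *[OF _ that] in force)
        then have "u (\<lambda>w. x w + y w) - u x \<le> u y" by (intro great) force
        then show "u (\<lambda>w. x w + y w) \<le> u x + u y" by simp
      next
        fix x and t :: real assume x: "x \<in> S" and t: "0 < t"
        have "u (\<lambda>w. t * x w) / t \<le> u x"
        proof (rule great)
          fix q assume "q \<in> C"
          then show "u (\<lambda>w. t * x w) / t \<le> q x"
            using low[of q "\<lambda>w. t * x w"] sublinear_on_scale[OF S sub x, of q t] t
            by (simp add: field_simps)
        qed
        then show "u (\<lambda>w. t * x w) \<le> t * u x" using t by (simp add: field_simps)
      qed
      moreover have "u x \<le> p x" if "x \<in> S" for x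
        using low[OF q0, of x] q0 CF that by (fastforce simp: F_def)
      moreover have "u x = 0" if "x \<notin> S" for x
      proof -
        have "q x = 0" if "q \<in> C" for q using CF that \<open>x \<notin> S\<close> by (auto simp: F_def)
        then show ?thesis using low[OF q0, of x] great[of 0 x] q0 by force
      qed
      ultimately have "u \<in> F" by (auto simp: F_def)
      moreover have "\<forall>a\<in>C. R a u" using low by (auto simp: R_def le_fun_def)
      ultimately show ?thesis by blast
    qed
  qed
  then obtain q where q: "q \<in> F" and min: "\<And>a. a \<in> F \<Longrightarrow> a \<le> q \<Longrightarrow> a = q"
    by (auto simp: R_def)
  show thesis
  proof (rule that)
    show "sublinear_on S q" "\<And>x. x \<in> S \<Longrightarrow> q x \<le> p x" using q by (auto simp: F_def)
    fix r x assume r: "sublinear_on S r" and rq: "\<And>x. x \<in> S \<Longrightarrow> r x \<le> q x" and x: "x \<in> S"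
    define r' where "r' = (\<lambda>x. if x \<in> S then r x else 0)"
    have "r' \<in> F" "r' \<le> q"
      using restr[OF r] q rq by (auto simp: F_def r'_def le_fun_def intro: order_trans)
    then have "r' = q" by (rule min)
    then show "r x = q x" using x by (auto simp: r'_def)
  qed
qed

text \<open>A minimal sublinear functional \<open>q\<close> equals each of its shifts, and
  \<open>q = sublinear_shift q v\<close> gives \<open>q x + q v \<le> q (x + v)\<close>, so that \<open>q\<close> is additive.\<close>

theorem hahn_banach_function_space:
  fixes S :: "('w \<Rightarrow> real) set"
  assumes S: "function_space S" and p: "sublinear_on S p" and v: "v \<in> S"
  shows "\<exists>f. (\<forall>x\<in>S. f x \<le> p x) \<and> f v = p v \<and>
    (\<forall>x\<in>S. \<forall>y\<in>S. f (\<lambda>w. x w + y w) = f x + f y) \<and> (\<forall>x\<in>S. \<forall>t. f (\<lambda>w. t * x w) = t * f x)"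
proof (rule exists_minimal_sublinear[OF S sublinear_on_shift[OF S p v]])
  have pv: "sublinear_shift p v x \<le> p x" if "x \<in> S" for x
    using sublinear_shift_le[OF S p v that, of 0] by simp
  fix f assume f: "sublinear_on S f" and fp: "\<And>x. x \<in> S \<Longrightarrow> f x \<le> sublinear_shift p v x"
    and min: "\<And>r x. sublinear_on S r \<Longrightarrow> (\<And>x. x \<in> S \<Longrightarrow> r x \<le> f x) \<Longrightarrow> x \<in> S \<Longrightarrow> r x = f x"
  have add: "f (\<lambda>w. x w + y w) = f x + f y" if x: "x \<in> S" and y: "y \<in> S" for x y
  proof -
    have "sublinear_shift f y x = f x"
      by (rule min[OF sublinear_on_shift[OF S f y] _ x]) (use sublinear_shift_le[OF S f y, of _ 0] in simp)
    then have "f x + f y \<le> f (\<lambda>w. x w + y w)" using sublinear_shift_le[OF S f y x, of 1] by simp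
    then show ?thesis using sublinear_on_add[OF f x y] by simp
  qed
  have neg: "f (\<lambda>w. - x w) = - f x" if "x \<in> S" for x
    using add[OF that function_spaceD(4)[OF S that]] sublinear_on_zero[OF S f] by simp
  have fpx: "f x \<le> p x" if "x \<in> S" for x using fp[OF that] pv[OF that] by simp
  \<comment> \<open>This is the reason for minimising below the shift of \<open>p\<close> along
    \<open>v\<close> and not below \<open>p\<close> itself: it forces
    \<open>f v = p v\<close>.\<close>
  have "f (\<lambda>w. - v w) \<le> - p v"
    using fp[OF function_spaceD(4)[OF S v]] sublinear_shift_le[OF S p v function_spaceD(4)[OF S v], of 1]
      sublinear_on_zero[OF S p] by simp
  then have "f v = p v" using neg[OF v] fpx[OF v] by simp
  moreover have "f (\<lambda>w. t * x w) = t * f x" if x: "x \<in> S" for x t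
  proof (cases "t \<ge> 0")
    case True
    then show ?thesis by (rule sublinear_on_scale[OF S f x])
  next
    case False
    then have "f (\<lambda>w. (-t) * x w) = (-t) * f x" by (intro sublinear_on_scale[OF S f x]) auto
    then show ?thesis using neg[OF function_spaceD(3)[OF S x, of t]] by simp
  qed
  ultimately show ?thesis using fpx add by blast
qed

section \<open>Positive functionals on \<open>L\<^sup>1\<close>\<close>

text \<open>The set function \<open>B \<mapsto> f (indicator B)\<close> is a measure dominated by
  \<open>Q\<close>; its Radon-Nikodym density is \<open>Z\<close>. The formula passes from
  indicators to integrable functions because both sides are continuous in the L1 distance.\<close>

lemma positive_functional_L1_representation:
  fixes Q :: "'w measure" and f :: "('w \<Rightarrow> real) \<Rightarrow> real"
  assumes Q: "prob_space Q"
    and add: "\<And>X Y. integrable Q X \<Longrightarrow> integrable Q Y \<Longrightarrow> f (\<lambda>w. X w + Y w) = f X + f Y"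
    and scale: "\<And>X t. integrable Q X \<Longrightarrow> f (\<lambda>w. t * X w) = t * f X"
    and bound: "\<And>X. integrable Q X \<Longrightarrow> f X \<le> (\<integral>w. \<bar>X w\<bar> \<partial>Q)"
    and pos: "\<And>X. integrable Q X \<Longrightarrow> (\<And>w. 0 \<le> X w) \<Longrightarrow> 0 \<le> f X"
  obtains Z where "Z \<in> borel_measurable Q" "\<And>w. 0 \<le> Z w" "\<And>w. Z w \<le> (1::real)"
    "\<And>X. integrable Q X \<Longrightarrow> f X = (\<integral>w. Z w * X w \<partial>Q)"
proof -
  interpret Q: prob_space Q by fact
  define m where "m B = ennreal (f (indicator B))" for B
  have ind: "integrable Q (indicator B :: 'w \<Rightarrow> real)" if "B \<in> sets Q" for B
    using that by (simp add: Q.emeasure_eq_measure)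
  have ind_nn: "0 \<le> f (indicator B)" if "B \<in> sets Q" for B by (rule pos[OF ind[OF that]]) simp
  have zero: "f (\<lambda>w. 0) = 0" using scale[of "\<lambda>w. 0" 0] by simp
  have m_le: "m B \<le> emeasure Q B" if "B \<in> sets Q" for B
  proof -
    have "f (indicator B) \<le> (\<integral>w. \<bar>indicator B w\<bar> \<partial>Q)" by (rule bound[OF ind[OF that]])
    also have "\<dots> = measure Q B" using that by simp
    finally show ?thesis by (simp add: m_def Q.emeasure_eq_measure ennreal_leI)
  qed
  \<comment> \<open>For a finite additive set function, continuity at the empty set suffices;
    domination by \<open>Q\<close> supplies it.\<close>
  have ca: "countably_additive (sets Q) m"
  proof (rule sets.empty_continuous_imp_countably_additive)
    show "positive (sets Q) m"
      using zero by (simp add: positive_def m_def indicator_def[abs_def])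
    show "additive (sets Q) m"
      unfolding additive_def
    proof (intro ballI impI)
      fix x y assume xy: "x \<in> sets Q" "y \<in> sets Q" "x \<inter> y = {}"
      have "(indicator (x \<union> y) :: 'w \<Rightarrow> real) = (\<lambda>w. indicator x w + indicator y w)"
        using xy by (auto simp: indicator_def fun_eq_iff)
      then have "f (indicator (x \<union> y)) = f (indicator x) + f (indicator y)"
        using add[OF ind ind] xy by simp
      then show "m (x \<union> y) = m x + m y"
        using ind_nn xy by (simp add: m_def ennreal_plus)
    qed
    show "\<forall>A\<in>sets Q. m A \<noteq> \<infinity>" by (simp add: m_def)
    fix A :: "nat \<Rightarrow> 'w set" assume A: "range A \<subseteq> sets Q" "decseq A" "(\<Inter>i. A i) = {}"
    have "(\<lambda>i. emeasure Q (A i)) \<longlonglongrightarrow> emeasure Q (\<Inter>i. A i)"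
      using A by (intro Lim_emeasure_decseq) auto
    then have "(\<lambda>i. emeasure Q (A i)) \<longlonglongrightarrow> 0" using A by simp
    from tendsto_sandwich[OF _ _ tendsto_const this] show "(\<lambda>i. m (A i)) \<longlonglongrightarrow> 0"
      using A m_le by auto
  qed
  define N where "N = measure_of (space Q) (sets Q) m"
  have sN: "sets N = sets Q" by (simp add: N_def)
  have eN: "emeasure N B = m B" if "B \<in> sets Q" for B
    unfolding N_def
    by (rule emeasure_measure_of_sigma[OF sets.sigma_algebra_axioms _ ca that])
       (use zero in \<open>simp add: positive_def m_def indicator_def[abs_def]\<close>)
  have ac: "absolutely_continuous Q N"
    unfolding absolutely_continuous_def
  proof
    fix B assume B: "B \<in> null_sets Q"
    then have "B \<in> sets Q" "emeasure Q B = 0" by auto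
    then show "B \<in> null_sets N" using eN[of B] m_le[of B] sN by (auto intro!: null_setsI)
  qed
  obtain g where g[measurable]: "g \<in> borel_measurable Q" and dg: "density Q g = N"
    using Q.Radon_Nikodym[OF ac sN] by auto
  have eg: "(\<integral>\<^sup>+w. g w * indicator B w \<partial>Q) \<le> emeasure Q B" if "B \<in> sets Q" for B
    using eN[OF that] m_le[OF that] dg that emeasure_density[OF g that] by simp
  have g1: "AE w in Q. g w \<le> 1"
  proof (rule ccontr)
    assume n: "\<not> ?thesis"
    define B where "B = {w\<in>space Q. 1 < g w}"
    have B[measurable]: "B \<in> sets Q" unfolding B_def by measurable
    \<comment> \<open>If \<open>g > 1\<close> held on a non-null set, the integral of
      \<open>g\<close> over it would exceed its measure, against \<open>eg\<close>.\<close>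
    have "(\<integral>\<^sup>+w. indicator B w \<partial>Q) < (\<integral>\<^sup>+w. g w * indicator B w \<partial>Q)"
    proof (rule nn_integral_less)
      show "(\<integral>\<^sup>+w. indicator B w \<partial>Q) \<noteq> \<infinity>" by (simp add: Q.emeasure_eq_measure)
      show "AE w in Q. indicator B w \<le> g w * indicator B w"
        by (rule AE_I2) (auto simp: B_def indicator_def)
      show "\<not> (AE w in Q. g w * indicator B w \<le> indicator B w)"
      proof
        assume "AE w in Q. g w * indicator B w \<le> indicator B w"
        then have "AE w in Q. g w \<le> 1"
          using AE_space by eventually_elim (rule ccontr, auto simp: B_def indicator_def not_le)
        with n show False by simp
      qed
    qed measurable
    with eg[OF B] show False by simp
  qed
  \<comment> \<open>The bound on \<open>g\<close> holds only almost everywhere; cutting off at 1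
    makes it hold at every point and keeps the values finite.\<close>
  define Z where "Z w = enn2real (min (g w) 1)" for w
  have Z[measurable]: "Z \<in> borel_measurable Q" unfolding Z_def by measurable
  have Z0: "0 \<le> Z w" for w by (simp add: Z_def)
  have Z1: "Z w \<le> 1" for w
    unfolding Z_def using enn2real_mono[of "min (g w) 1" 1] by simp
  have ZN: "density Q (\<lambda>w. ennreal (Z w)) = N"
    unfolding dg[symmetric]
  proof (rule density_cong)
    show "AE w in Q. ennreal (Z w) = g w" using g1
    proof eventually_elim
      case (elim w)
      then have "g w < top" using le_less_trans[OF elim, of top] by simp
      then show ?case using elim by (simp add: Z_def min_absorb1)
    qed
  qed measurable
  \<comment> \<open>Continuity of \<open>f\<close> in L1, used in the limit case of the
    induction.\<close>
  have diff: "\<bar>f X - f Y\<bar> \<le> (\<integral>w. \<bar>X w - Y w\<bar> \<partial>Q)" if X: "integrable Q X" and Y: "integrable Q Y" for X Y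
  proof -
    have *: "f X - f Y \<le> (\<integral>w. \<bar>X w - Y w\<bar> \<partial>Q)" if X: "integrable Q X" and Y: "integrable Q Y" for X Y
    proof -
      have "f (\<lambda>w. X w + (-1) * Y w) = f X + (-1) * f Y" using X Y by (subst add; simp add: scale[of Y "-1", simplified])
      moreover have "f (\<lambda>w. X w + (-1) * Y w) \<le> (\<integral>w. \<bar>X w + (-1) * Y w\<bar> \<partial>Q)" using X Y by (intro bound) simp
      ultimately show ?thesis by simp
    qed
    show ?thesis using *[OF X Y] *[OF Y X] by (simp add: abs_minus_commute abs_le_iff)
  qed
  have ZX: "integrable Q (\<lambda>w. Z w * X w)" if "integrable Q X" for X
    by (rule Bochner_Integration.integrable_bound[OF that])
       (use that in \<open>auto simp: abs_mult Z0 intro!: mult_left_le_one_le Z1\<close>)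
  have "f X = (\<integral>w. Z w * X w \<partial>Q)" if "integrable Q X" for X
    using that
  proof (induct X rule: integrable_induct)
    case (base A c)
    have "ennreal (f (indicator A)) = ennreal (\<integral>w. Z w * indicator A w \<partial>Q)"
    proof -
      have "ennreal (f (indicator A)) = (\<integral>\<^sup>+w. ennreal (Z w) * indicator A w \<partial>Q)"
        using eN[OF base(1)] emeasure_density[of "\<lambda>w. ennreal (Z w)" Q A] base ZN by (simp add: m_def)
      also have "\<dots> = (\<integral>\<^sup>+w. ennreal (Z w * indicator A w) \<partial>Q)"
        by (intro nn_integral_cong) (auto simp: indicator_def)
      also have "\<dots> = ennreal (\<integral>w. Z w * indicator A w \<partial>Q)"
        by (rule nn_integral_eq_integral[OF ZX[OF ind[OF base(1)]]]) (simp add: Z0)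
      finally show ?thesis .
    qed
    moreover have "0 \<le> (\<integral>w. Z w * indicator A w \<partial>Q)" by (simp add: Z0)
    ultimately have "f (indicator A) = (\<integral>w. Z w * indicator A w \<partial>Q)"
      using ind_nn[OF base(1)] by simp
    moreover have "f (\<lambda>w. indicator A w *\<^sub>R c) = c * f (indicator A)"
      using scale[OF ind[OF base(1)], of c] by (simp add: mult.commute)
    moreover have "(\<integral>w. Z w * (indicator A w *\<^sub>R c) \<partial>Q) = c * (\<integral>w. Z w * indicator A w \<partial>Q)"
      by (subst integral_mult_right_zero[symmetric]) (simp add: ac_simps)
    ultimately show ?case by simp
  next
    case (add X Y)
    then show ?case using assms(2)[of X Y] ZX[of X] ZX[of Y] by (simp add: distrib_left)
  next
    case (lim X s)
    \<comment> \<open>The approximants satisfy \<open>|s i| \<le> 2 * |X|\<close>, hence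
      \<open>|X - s i| \<le> 3 * |X|\<close>.\<close>
    have b: "integrable Q (\<lambda>w. 3 * \<bar>X w\<bar>)" using lim by simp
    have "(\<lambda>i. \<integral>w. \<bar>X w - s i w\<bar> \<partial>Q) \<longlonglongrightarrow> (\<integral>w. 0 \<partial>Q)"
    proof (rule integral_dominated_convergence[OF _ _ b])
      show "AE w in Q. (\<lambda>i. \<bar>X w - s i w\<bar>) \<longlonglongrightarrow> 0"
      proof (rule AE_I2)
        fix w assume "w \<in> space Q"
        then have "(\<lambda>i. \<bar>X w - s i w\<bar>) \<longlonglongrightarrow> \<bar>X w - X w\<bar>"
          by (intro tendsto_intros lim)
        then show "(\<lambda>i. \<bar>X w - s i w\<bar>) \<longlonglongrightarrow> 0" by simp
      qed
      show "AE w in Q. norm \<bar>X w - s i w\<bar> \<le> 3 * \<bar>X w\<bar>" for i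
        using lim(4)[of _ i] by (intro AE_I2) (force simp: abs_le_iff)
    qed (use lim in auto)
    then have t: "(\<lambda>i. \<integral>w. \<bar>X w - s i w\<bar> \<partial>Q) \<longlonglongrightarrow> 0" by simp
    \<comment> \<open>One distance is paid for moving from \<open>X\<close> to \<open>s i\<close>
      under \<open>f\<close>, the other for moving back under the integral against \<open>Z\<close>,
      where \<open>0 \<le> Z \<le> 1\<close> is used.\<close>
    have "\<bar>f X - (\<integral>w. Z w * X w \<partial>Q)\<bar> \<le> 2 * (\<integral>w. \<bar>X w - s i w\<bar> \<partial>Q)" for i
    proof -
      have "\<bar>(\<integral>w. Z w * s i w \<partial>Q) - (\<integral>w. Z w * X w \<partial>Q)\<bar> = \<bar>\<integral>w. Z w * (s i w - X w) \<partial>Q\<bar>"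
        using ZX[OF lim(1)[of i]] ZX[OF lim(5)] by (simp add: right_diff_distrib)
      also have "\<dots> \<le> (\<integral>w. \<bar>Z w * (s i w - X w)\<bar> \<partial>Q)" by (rule integral_abs_bound)
      also have "\<dots> \<le> (\<integral>w. \<bar>X w - s i w\<bar> \<partial>Q)"
        using lim(1)[of i] lim(5) ZX[of "\<lambda>w. \<bar>X w - s i w\<bar>"]
        by (intro integral_mono) (auto simp: abs_mult Z0 abs_minus_commute intro!: mult_left_le_one_le Z1)
      finally show ?thesis using diff[OF lim(5) lim(1)[of i]] lim(2)[of i] by linarith
    qed
    moreover have "(\<lambda>i. 2 * (\<integral>w. \<bar>X w - s i w\<bar> \<partial>Q)) \<longlonglongrightarrow> 0"
      using tendsto_mult_right_zero[OF t] .
    ultimately have "\<bar>f X - (\<integral>w. Z w * X w \<partial>Q)\<bar> \<le> 0"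
      using LIMSEQ_le_const by blast
    then show ?case by simp
  qed
  with Z Z0 Z1 that show thesis by blast
qed

section \<open>The conjugate function\<close>

context
  fixes a :: ereal and U U' :: "real \<Rightarrow> real"
  assumes util: "utility a U U'"
begin

section \<open>Domain of the utility function and tangent bounds\<close>

lemma utility_derivative: "x \<in> dom_U a \<Longrightarrow> (U has_real_derivative U' x) (at x)"
  using util by (simp add: utility_def)

lemma dom_U_nonempty: "dom_U a \<noteq> {}"
proof -
  have "a < \<infinity>" using util by (simp add: utility_def)
  then obtain r where "a < ereal r" by (auto simp: less_PInf_Ex_of_nat)
  then show ?thesis by (auto simp: dom_U_def)
qed

lemma open_dom_U: "open (dom_U a)"
  unfolding dom_U_def by (intro open_Collect_less continuous_intros)

lemma dom_U_upward: "x \<in> dom_U a \<Longrightarrow> x \<le> y \<Longrightarrow> y \<in> dom_U a"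
  unfolding dom_U_def using less_le_trans[of a "ereal x" "ereal y"] by simp

lemma convex_dom_U: "convex (dom_U a)"
  by (rule is_interval_convex) (auto simp: is_interval_1 intro: dom_U_upward)

lemma utility_below_tangent:
  assumes "z \<in> dom_U a" "x \<in> dom_U a"
  shows "U x \<le> U z + U' z * (x - z)"
proof -
  have "convex_on (dom_U a) (\<lambda>x. - U x)"
  proof (rule convex_onI[OF _ convex_dom_U])
    fix t x y :: real assume *: "0 < t" "t < 1" "x \<in> dom_U a" "y \<in> dom_U a"
    have "(1 - t) * U x + t * U y \<le> U ((1 - t) * x + t * y)"
    proof (cases "x = y")
      case True
      then show ?thesis by (simp add: algebra_simps)
    next
      case False
      then show ?thesis using util * by (auto simp: utility_def strictly_concave_on_def intro: less_imp_le)
    qed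
    then show "- U ((1 - t) *\<^sub>R x + t *\<^sub>R y) \<le> (1 - t) * - U x + t * - U y" by simp
  qed
  moreover have "((\<lambda>x. - U x) has_real_derivative - U' z) (at z within dom_U a)"
    using DERIV_minus[OF utility_derivative[OF assms(1)]] by (rule has_field_derivative_at_within)
  moreover have "z \<in> interior (dom_U a)" using assms open_dom_U by (simp add: interior_open)
  ultimately have "- U x - - U z \<ge> - U' z * (x - z)"
    using convex_on_imp_above_tangent[OF _ convex_connected[OF convex_dom_U]] assms by blast
  then show ?thesis by simp
qed

lemma eventually_dom_U_left_end: "eventually (\<lambda>x. x \<in> dom_U a) (at_left_end a)"
proof (cases "a = -\<infinity>")
  case True
  then show ?thesis by (simp add: at_left_end_def dom_U_def)
next
  case False
  then obtain r where r: "a = ereal r" using util by (cases a) (auto simp: utility_def)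
  show ?thesis unfolding r at_left_end_def dom_U_def
    by (simp add: eventually_at_right_less)
qed

lemma at_left_end_neq_bot: "at_left_end a \<noteq> bot"
  by (simp add: at_left_end_def trivial_limit_at_right_real)

text \<open>Without this bound the real supremum in \<open>conj_V\<close> would carry no
  information. Since \<open>U'\<close> exceeds \<open>y\<close> somewhere near the left end and
  falls below \<open>y\<close> far to the right, a tangent at a point of the first kind controls
  negative \<open>x\<close> and one of the second kind controls \<open>x \<ge> 0\<close>.\<close>

lemma bdd_above_conj_V:
  assumes y: "0 < y"
  shows "bdd_above ((\<lambda>x. U x - x * y) ` dom_U a)"
proof -
  have "eventually (\<lambda>x. y \<le> U' x) (at_left_end a)"
    using util by (auto simp: utility_def filterlim_at_top)
  with eventually_dom_U_left_end have "eventually (\<lambda>x. x \<in> dom_U a \<and> y \<le> U' x) (at_left_end a)"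
    by eventually_elim simp
  then obtain z1 where z1: "z1 \<in> dom_U a" "y \<le> U' z1"
    using eventually_happens' [OF at_left_end_neq_bot] by blast
  obtain d where d: "d \<in> dom_U a" using dom_U_nonempty by auto
  have "eventually (\<lambda>x. U' x < y) at_top"
    using util y by (auto simp: utility_def intro: order_tendstoD)
  with eventually_ge_at_top[of d] have "eventually (\<lambda>x. x \<in> dom_U a \<and> U' x < y) at_top"
    by eventually_elim (use dom_U_upward[OF d] in auto)
  then obtain z2 where z2: "z2 \<in> dom_U a" "U' z2 < y"
    using eventually_happens'[OF trivial_limit_at_top_linorder] by blast
  show ?thesis
  proof (rule bdd_aboveI2)
    fix x assume x: "x \<in> dom_U a"
    show "U x - x * y \<le> max (U z1 - U' z1 * z1) (U z2 - U' z2 * z2)"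
    proof (cases "x \<ge> 0")
      case True
      then have "U' z2 * x \<le> y * x" using z2 by (intro mult_right_mono) auto
      then show ?thesis using utility_below_tangent[OF z2(1) x] by (simp add: algebra_simps)
    next
      case False
      then have "U' z1 * x \<le> y * x" using z1 by (intro mult_right_mono_neg) auto
      then show ?thesis using utility_below_tangent[OF z1(1) x] by (simp add: algebra_simps)
    qed
  qed
qed

section \<open>Convexity and growth of the conjugate\<close>

lemma conj_V_upper: "0 < y \<Longrightarrow> x \<in> dom_U a \<Longrightarrow> U x - x * y \<le> conj_V a U y"
  unfolding conj_V_def by (rule cSUP_upper[OF _ bdd_above_conj_V])

lemma conj_V_least: "(\<And>x. x \<in> dom_U a \<Longrightarrow> U x - x * y \<le> c) \<Longrightarrow> conj_V a U y \<le> c"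
  unfolding conj_V_def by (rule cSUP_least[OF dom_U_nonempty])

text \<open>Substitute for monotonicity, which \<open>V\<close> may lack: each affine function
  \<open>U x - x * y\<close> of \<open>y\<close> is largest at an end of the interval, the left one
  for \<open>x \<ge> 0\<close> and the right one for \<open>x < 0\<close>.\<close>

lemma conj_V_le_max_endpoints:
  assumes "0 < b" "b \<le> u" "u \<le> v"
  shows "conj_V a U u \<le> max (conj_V a U b) (conj_V a U v)"
proof (rule conj_V_least)
  fix x assume x: "x \<in> dom_U a"
  show "U x - x * u \<le> max (conj_V a U b) (conj_V a U v)"
  proof (cases "x \<ge> 0")
    case True
    then have "x * b \<le> x * u" using assms by (intro mult_left_mono) auto
    then show ?thesis using conj_V_upper[OF _ x, of b] assms by simp
  next
    case False
    then have "x * v \<le> x * u" using assms by (intro mult_left_mono_neg) auto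
    then show ?thesis using conj_V_upper[OF _ x, of v] assms by simp
  qed
qed

text \<open>A supremum of affine functions is convex, and a finite convex function on an open
  interval is continuous. This serves the measurability of \<open>V\<close> composed with a
  density.\<close>

lemma continuous_on_conj_V: "continuous_on {0<..} (conj_V a U)"
proof (rule convex_on_continuous[OF open_greaterThan], rule convex_onI)
  fix t x y :: real assume *: "0 < t" "t < 1" "x \<in> {0<..}" "y \<in> {0<..}"
  show "conj_V a U ((1 - t) *\<^sub>R x + t *\<^sub>R y) \<le> (1 - t) * conj_V a U x + t * conj_V a U y"
  proof (rule conj_V_least)
    fix z assume z: "z \<in> dom_U a"
    have "(1 - t) * (U z - z * x) + t * (U z - z * y) \<le> (1 - t) * conj_V a U x + t * conj_V a U y"
      using * z by (intro add_mono mult_left_mono conj_V_upper) auto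
    then show "U z - z * ((1 - t) *\<^sub>R x + t *\<^sub>R y) \<le> (1 - t) * conj_V a U x + t * conj_V a U y"
      by (simp add: algebra_simps)
  qed
qed simp

text \<open>Integrated form of the elasticity condition: a lower bound \<gamma> on
  \<open>x * U' x / U x\<close> makes \<open>U (t * x)\<close> divided by
  \<open>t powr \<gamma>\<close> nonincreasing in \<open>t\<close>.\<close>

lemma utility_growth_at_bot:
  assumes a: "a = -\<infinity>"
  obtains \<gamma> x0 where "\<gamma> > 1" "x0 < 0"
    "\<And>x s. x \<le> x0 \<Longrightarrow> s \<ge> 1 \<Longrightarrow> U (s * x) \<le> s powr \<gamma> * U x"
proof -
  have dom: "x \<in> dom_U a" for x by (simp add: dom_U_def a)
  have "1 < Liminf at_bot (\<lambda>x. ereal (x * U' x / U x))"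
    using util a by (simp add: utility_def)
  then obtain \<gamma> where \<gamma>: "1 < ereal \<gamma>"
    and less: "ereal \<gamma> < Liminf at_bot (\<lambda>x. ereal (x * U' x / U x))"
    using ereal_dense2 by blast
  have "eventually (\<lambda>x. \<gamma> < x * U' x / U x) at_bot"
    using less_LiminfD[OF less] by simp
  moreover have "eventually (\<lambda>x. 0 \<le> U' x) at_bot"
    using util a by (auto simp: utility_def filterlim_at_top at_left_end_def)
  ultimately have "eventually (\<lambda>x. \<gamma> < x * U' x / U x \<and> 0 \<le> U' x \<and> x < 0) at_bot"
    using eventually_gt_at_bot[of 0] by eventually_elim simp
  then obtain x0 where x0: "\<And>x. x \<le> x0 \<Longrightarrow> \<gamma> < x * U' x / U x \<and> 0 \<le> U' x \<and> x < 0"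
    by (auto simp: eventually_at_bot_linorder)
  have g1: "\<gamma> > 1" using \<gamma> by simp
  \<comment> \<open>Here \<open>x * U' x \<le> 0\<close> while its quotient by \<open>U x\<close> is
    positive, so \<open>U x < 0\<close>; multiplying by it reverses the elasticity bound.\<close>
  have neg: "U x < 0" and ela: "x * U' x \<le> \<gamma> * U x" if "x \<le> x0" for x
  proof -
    have *: "0 < x * U' x / U x" "x * U' x \<le> 0"
      using x0[OF that] g1 by (auto simp: mult_nonpos_nonneg)
    then show "U x < 0" by (auto simp: zero_less_divide_iff)
    then show "x * U' x \<le> \<gamma> * U x" using x0[OF that] by (simp add: field_simps)
  qed
  show thesis
  proof (rule that[OF g1])
    show "x0 < 0" using x0 by simp
    fix x s :: real assume x: "x \<le> x0" and s: "s \<ge> 1"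
    have x_neg: "x < 0" using x0[OF x] by simp
    \<comment> \<open>Its derivative is
      \<open>(z * U' z - \<gamma> * U z) * t powr (-\<gamma> - 1)\<close> at
      \<open>z = t * x\<close>, which \<open>ela\<close> makes nonpositive.\<close>
    define F where "F t = U (t * x) * t powr (-\<gamma>)" for t
    have "F s \<le> F 1"
    proof (rule DERIV_nonpos_imp_nonincreasing[OF s])
      fix t assume t: "1 \<le> t" "t \<le> s"
      have tx: "t * x \<le> x0"
        using mult_right_mono_neg[OF t(1), of x] x x_neg by linarith
      have d: "((\<lambda>t. U (t * x)) has_real_derivative U' (t * x) * x) (at t)"
        using utility_derivative[OF dom] by (rule DERIV_chain2) (auto intro!: derivative_eq_intros)
      have "(F has_real_derivative
          (U' (t * x) * x) * t powr (-\<gamma>) + ((-\<gamma>) * t powr (-\<gamma> - 1)) * U (t * x)) (at t)"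
        unfolding F_def using t
        by (intro DERIV_mult d has_real_derivative_powr) auto
      moreover have "(U' (t * x) * x) * t powr (-\<gamma>) + ((-\<gamma>) * t powr (-\<gamma> - 1)) * U (t * x)
          = ((t * x) * U' (t * x) - \<gamma> * U (t * x)) * t powr (-\<gamma> - 1)"
      proof -
        have "t powr (-\<gamma>) = t * t powr (-\<gamma> - 1)" using t by (simp add: powr_mult_base)
        then show ?thesis by (simp add: algebra_simps)
      qed
      moreover have "\<dots> \<le> 0" using ela[OF tx] by (intro mult_nonpos_nonneg) auto
      ultimately show "\<exists>y. (F has_real_derivative y) (at t) \<and> y \<le> 0" by metis
    qed
    then have "U (s * x) / s powr \<gamma> \<le> U x" by (simp add: F_def powr_minus divide_inverse)
    then show "U (s * x) \<le> s powr \<gamma> * U x" using s by (simp add: field_simps)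
  qed
qed

text \<open>For \<open>a = -\<infinity>\<close>, with \<open>s = l powr (1 / (\<gamma> - 1))\<close> and \<open>x = s * z\<close> one has
  \<open>U x - x * (l * y) \<le> s powr \<gamma> * (U z - z * y)\<close>, because \<open>l * s = s powr \<gamma>\<close>.\<close>

lemma conj_V_scale_growth:
  assumes l: "1 \<le> l"
  obtains A B where "0 \<le> A" "0 \<le> B"
    "\<And>y. 0 < y \<Longrightarrow> conj_V a U (l * y) \<le> A * conj_V_plus a U y + B * y"
proof (cases "a = -\<infinity>")
  case False
  then obtain r where r: "a = ereal r" using util by (cases a) (auto simp: utility_def)
  \<comment> \<open>With a finite left end, \<open>- x\<close> is at most \<open>|r|\<close> on the
    domain, so passing from \<open>y\<close> to \<open>l * y\<close> raises
    \<open>U x - x * y\<close> by at most \<open>(l - 1) * |r| * y\<close>.\<close>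
  have "conj_V a U (l * y) \<le> 1 * conj_V_plus a U y + ((l - 1) * \<bar>r\<bar>) * y" if y: "0 < y" for y
  proof (rule conj_V_least)
    fix x assume x: "x \<in> dom_U a"
    then have "- x \<le> \<bar>r\<bar>" by (auto simp: dom_U_def r)
    then have "(- x) * ((l - 1) * y) \<le> \<bar>r\<bar> * ((l - 1) * y)"
      using l y by (intro mult_right_mono) auto
    moreover have "U x - x * y \<le> conj_V_plus a U y"
      using conj_V_upper[OF y x] by (simp add: conj_V_plus_def)
    ultimately show "U x - x * (l * y) \<le> 1 * conj_V_plus a U y + ((l - 1) * \<bar>r\<bar>) * y"
      by (simp add: algebra_simps)
  qed
  then show thesis using that[of 1 "(l - 1) * \<bar>r\<bar>"] l by simp
next
  case True
  obtain \<gamma> x0 where g: "\<gamma> > 1" and x0: "x0 < 0"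
    and gr: "\<And>x s. x \<le> x0 \<Longrightarrow> s \<ge> 1 \<Longrightarrow> U (s * x) \<le> s powr \<gamma> * U x"
    using utility_growth_at_bot[OF True] by metis
  have dom: "x \<in> dom_U a" for x by (simp add: dom_U_def True)
  define s where "s = l powr (1 / (\<gamma> - 1))"
  have s1: "s \<ge> 1" using l g by (simp add: s_def ge_one_powr_ge_zero)
  have "s powr (\<gamma> - 1) = l" using l g by (simp add: s_def powr_powr)
  moreover have "s powr \<gamma> = s * s powr (\<gamma> - 1)" using s1 by (simp add: powr_mult_base)
  ultimately have ls: "s powr \<gamma> = l * s" by simp
  have A1: "1 \<le> s powr \<gamma>" using s1 g by (simp add: ge_one_powr_ge_zero)
  have "conj_V a U (l * y) \<le> s powr \<gamma> * conj_V_plus a U y + ((l - 1) * (s * \<bar>x0\<bar>)) * y"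
    if y: "0 < y" for y
  proof (rule conj_V_least)
    fix x assume x: "x \<in> dom_U a"
    have B0: "0 \<le> ((l - 1) * (s * \<bar>x0\<bar>)) * y" using l y s1 by simp
    have le: "U z - z * y \<le> conj_V_plus a U y" for z
      using conj_V_upper[OF y dom[of z]] by (simp add: conj_V_plus_def)
    show "U x - x * (l * y) \<le> s powr \<gamma> * conj_V_plus a U y + ((l - 1) * (s * \<bar>x0\<bar>)) * y"
    proof (cases "x \<le> s * x0")
      case True
      define z where "z = x / s"
      have xz: "x = s * z" and z: "z \<le> x0" using s1 True by (auto simp: z_def field_simps)
      have "U x - x * (l * y) \<le> s powr \<gamma> * U z - (l * s) * (z * y)"
        using gr[OF z s1] by (simp add: xz algebra_simps)
      also have "\<dots> = s powr \<gamma> * (U z - z * y)" unfolding ls[symmetric] by (simp add: algebra_simps)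
      also have "\<dots> \<le> s powr \<gamma> * conj_V_plus a U y" by (intro mult_left_mono le) simp
      finally show ?thesis using B0 by linarith
    next
      case False
      \<comment> \<open>To the right of \<open>s * x0\<close> the argument is that of a finite left
        end.\<close>
      then have "- x \<le> s * \<bar>x0\<bar>" using x0 by simp
      then have "(- x) * ((l - 1) * y) \<le> (s * \<bar>x0\<bar>) * ((l - 1) * y)"
        using l y by (intro mult_right_mono) auto
      moreover have "conj_V_plus a U y \<le> s powr \<gamma> * conj_V_plus a U y"
        using mult_right_mono[OF A1, of "conj_V_plus a U y"] by (simp add: conj_V_plus_def)
      ultimately show ?thesis using le[of x] by (simp add: algebra_simps)
    qed
  qed
  then show thesis using that[of "s powr \<gamma>" "(l - 1) * (s * \<bar>x0\<bar>)"] l s1 by simp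
qed

end

section \<open>Measures with finite loss-entropy\<close>

lemma borel_measurable_dens [measurable]: "dens P Q \<in> borel_measurable P"
  unfolding dens_def by measurable

lemma dens_nonneg: "0 \<le> dens P Q w"
  by (simp add: dens_def)

lemma M_V_hatD:
  assumes "Q \<in> M_V_hat a U P K"
  shows "sets Q = sets P" "prob_space Q" "absolutely_continuous P Q"
    "X \<in> K \<Longrightarrow> integrable Q X" "X \<in> K \<Longrightarrow> integral\<^sup>L Q X \<le> 0" "finite_loss_entropy a U P Q"
    "borel_measurable Q = borel_measurable P"
  using assms measurable_cong_sets[of Q P borel borel] by (auto simp: M_V_hat_def M1_def)

context prob_space
begin

lemma AE_dens_density:
  assumes [measurable]: "D \<in> borel_measurable M" and D: "\<And>w. 0 \<le> D w"
  shows "AE w in M. dens M (density M (\<lambda>w. ennreal (D w))) w = D w"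
proof -
  have "AE w in M. ennreal (D w) = RN_deriv M (density M (\<lambda>w. ennreal (D w))) w"
    by (rule RN_deriv_unique) auto
  then show ?thesis by eventually_elim (metis D dens_def enn2real_ennreal)
qed

lemma integrable_dens_iff:
  assumes "Q \<in> M_V_hat a U M K" and "X \<in> borel_measurable M"
  shows "integrable Q X \<longleftrightarrow> integrable M (\<lambda>w. dens M Q w * X w)"
    and "integral\<^sup>L Q X = (\<integral>w. dens M Q w * X w \<partial>M)"
proof -
  have "sigma_finite_measure Q"
    using M_V_hatD(2)[OF assms(1)] by (simp add: prob_space_imp_sigma_finite)
  then show "integrable Q X \<longleftrightarrow> integrable M (\<lambda>w. dens M Q w * X w)"
    and "integral\<^sup>L Q X = (\<integral>w. dens M Q w * X w \<partial>M)"
    using RN_deriv_integrable[OF _ M_V_hatD(3,1)[OF assms(1)] assms(2)]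
      RN_deriv_integral[OF _ M_V_hatD(3,1)[OF assms(1)] assms(2)]
    by (auto simp: dens_def)
qed

lemma dens_integral:
  assumes "Q \<in> M_V_hat a U M K"
  shows "integrable M (dens M Q)" "(\<integral>w. dens M Q w \<partial>M) = 1"
proof -
  interpret Q: prob_space Q by (rule M_V_hatD(2)[OF assms])
  show "integrable M (dens M Q)" "(\<integral>w. dens M Q w \<partial>M) = 1"
    using integrable_dens_iff[OF assms, of "\<lambda>w. 1"] Q.prob_space by simp_all
qed

text \<open>The indicator keeps the density in \<open>{b..}\<close> with \<open>b > 0\<close>, where
  \<open>V\<close> is continuous; at 0 the conjugate is not under control.\<close>

lemma borel_measurable_conj_V_plus_dens:
  assumes "utility a U U'" "0 < b"
  shows "(\<lambda>w. conj_V_plus a U (dens M Q w) * indicator {w. dens M Q w \<ge> b} w) \<in> borel_measurable M"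
proof -
  have "continuous_on {b..} (conj_V_plus a U)"
    unfolding conj_V_plus_def
    by (intro continuous_intros continuous_on_subset[OF continuous_on_conj_V[OF assms(1)]])
       (use assms(2) in auto)
  then have [measurable]: "(\<lambda>y. indicator {b..} y *\<^sub>R conj_V_plus a U y) \<in> borel_measurable borel"
    by (intro borel_measurable_continuous_on_indicator) auto
  have "(\<lambda>w. indicator {b..} (dens M Q w) *\<^sub>R conj_V_plus a U (dens M Q w)) \<in> borel_measurable M"
    by measurable
  moreover have "(\<lambda>w. indicator {b..} (dens M Q w) *\<^sub>R conj_V_plus a U (dens M Q w))
      = (\<lambda>w. conj_V_plus a U (dens M Q w) * indicator {w. dens M Q w \<ge> b} w)"
    by (auto simp: indicator_def fun_eq_iff)
  ultimately show ?thesis by simp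
qed

text \<open>With \<open>m\<close> the larger of the two densities and
  \<open>l * b \<le> d \<le> l * m\<close>, the value \<open>V d\<close> is at most
  \<open>V (l * b)\<close> or \<open>V (l * m)\<close>, and the latter is at most
  \<open>A * V\<^sup>+ m + B * m\<close>. Two dominating measures are allowed so that mixtures are
  covered as well as bounded changes of density.\<close>

lemma finite_loss_entropy_dominated:
  assumes u: "utility a U U'"
    and Q1: "Q1 \<in> M_V_hat a U M K" and Q2: "Q2 \<in> M_V_hat a U M K" and l: "1 \<le> l"
    and le: "AE w in M. dens M Q w \<le> l * max (dens M Q1 w) (dens M Q2 w)"
  shows "finite_loss_entropy a U M Q"
proof -
  let ?V = "conj_V_plus a U" and ?d = "dens M Q" and ?d1 = "dens M Q1" and ?d2 = "dens M Q2"
  have V0: "0 \<le> ?V y" for y by (simp add: conj_V_plus_def)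
  obtain b1 where b1: "0 < b1"
    "(\<integral>\<^sup>+w. ennreal (?V (?d1 w) * indicator {w. ?d1 w \<ge> b1} w) \<partial>M) < \<infinity>"
    using M_V_hatD(6)[OF Q1] by (auto simp: finite_loss_entropy_def)
  obtain b2 where b2: "0 < b2"
    "(\<integral>\<^sup>+w. ennreal (?V (?d2 w) * indicator {w. ?d2 w \<ge> b2} w) \<partial>M) < \<infinity>"
    using M_V_hatD(6)[OF Q2] by (auto simp: finite_loss_entropy_def)
  define G1 where "G1 w = ?V (?d1 w) * indicator {w. ?d1 w \<ge> b1} w" for w
  define G2 where "G2 w = ?V (?d2 w) * indicator {w. ?d2 w \<ge> b2} w" for w
  have [measurable]: "G1 \<in> borel_measurable M" "G2 \<in> borel_measurable M"
    unfolding G1_def[abs_def] G2_def[abs_def]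
    by (rule borel_measurable_conj_V_plus_dens[OF u b1(1)], rule borel_measurable_conj_V_plus_dens[OF u b2(1)])
  have G0: "0 \<le> G1 w" "0 \<le> G2 w" for w using V0 by (auto simp: G1_def G2_def)
  have G: "integrable M G1" "integrable M G2"
    using b1(2) b2(2) G0 by (auto intro!: integrableI_nonneg simp flip: G1_def G2_def)
  \<comment> \<open>With the larger threshold, whichever density attains \<open>m \<ge> b\<close>
    lies above its own threshold, so that \<open>V\<^sup>+ m\<close> is \<open>G1\<close> or
    \<open>G2\<close>.\<close>
  define b where "b = max b1 b2"
  have b: "0 < b" "0 < l * b" using b1(1) l by (auto simp: b_def)
  obtain A B where AB: "0 \<le> A" "0 \<le> B"
    and gr: "\<And>y. 0 < y \<Longrightarrow> conj_V a U (l * y) \<le> A * ?V y + B * y"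
    using conj_V_scale_growth[OF u l] by metis
  \<comment> \<open>The integrable majorant: a constant for the endpoint \<open>l * b\<close>, the
    two loss-entropy integrands, and the densities for the linear term.\<close>
  define H where "H w = \<bar>conj_V a U (l * b)\<bar> + A * (G1 w + G2 w) + B * (?d1 w + ?d2 w)" for w
  have intH: "integrable M H"
    unfolding H_def using G dens_integral(1)[OF Q1] dens_integral(1)[OF Q2] by simp
  have "AE w in M. ?V (?d w) * indicator {w. ?d w \<ge> l * b} w \<le> H w"
    using le
  proof eventually_elim
    case (elim w)
    have H0: "0 \<le> H w" using AB G0[of w] dens_nonneg[of M Q1 w] dens_nonneg[of M Q2 w] by (simp add: H_def)
    show ?case
    proof (cases "?d w \<ge> l * b")
      case True
      define m where "m = max (?d1 w) (?d2 w)"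
      have "l * b \<le> l * m" using True elim by (simp add: m_def)
      then have m: "b \<le> m" using l by simp
      have "conj_V a U (?d w) \<le> max (conj_V a U (l * b)) (conj_V a U (l * m))"
        using conj_V_le_max_endpoints[OF u b(2) True] elim by (simp add: m_def)
      moreover have "conj_V a U (l * m) \<le> A * ?V m + B * m" using gr[of m] m b by simp
      moreover have "A * ?V m \<le> A * (G1 w + G2 w)"
      proof (rule mult_left_mono[OF _ AB(1)])
        show "?V m \<le> G1 w + G2 w"
        proof (cases "m = ?d1 w")
          case True
          then have "?V m = G1 w" using m by (simp add: G1_def b_def)
          then show ?thesis using G0(2)[of w] by simp
        next
          case False
          then have "m = ?d2 w" by (auto simp: m_def max_def split: if_splits)
          then have "?V m = G2 w" using m by (simp add: G2_def b_def)
          then show ?thesis using G0(1)[of w] by simp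
        qed
      qed
      moreover have "B * m \<le> B * (?d1 w + ?d2 w)"
        using dens_nonneg[of M Q1 w] dens_nonneg[of M Q2 w] AB by (intro mult_left_mono) (auto simp: m_def)
      moreover have "0 \<le> A * (G1 w + G2 w)" "0 \<le> B * (?d1 w + ?d2 w)"
        using AB G0[of w] dens_nonneg[of M Q1 w] dens_nonneg[of M Q2 w] by auto
      ultimately have "conj_V a U (?d w) \<le> H w" unfolding H_def by linarith
      then show ?thesis using H0 True by (simp add: conj_V_plus_def)
    qed (use H0 in simp)
  qed
  then have "(\<integral>\<^sup>+w. ennreal (?V (?d w) * indicator {w. ?d w \<ge> l * b} w) \<partial>M) \<le> (\<integral>\<^sup>+w. ennreal (H w) \<partial>M)"
    by (intro nn_integral_mono_AE) (auto elim!: eventually_mono intro: ennreal_leI)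
  also have "\<dots> \<le> (\<integral>\<^sup>+w. ennreal (norm (H w)) \<partial>M)" by (intro nn_integral_mono ennreal_leI) simp
  also have "\<dots> < \<infinity>" using intH by (simp add: integrable_iff_bounded)
  finally show ?thesis unfolding finite_loss_entropy_def using b(2) by blast
qed

text \<open>The common criterion behind \<open>M_V_hat_mixture\<close> and
  \<open>M_V_hat_tilt\<close>: normalisation and the inequalities on \<open>K\<close> are given, and
  finite loss-entropy comes from domination.\<close>

lemma density_in_M_V_hat:
  assumes u: "utility a U U'" and K: "K \<subseteq> borel_measurable M"
    and Q1: "Q1 \<in> M_V_hat a U M K" and Q2: "Q2 \<in> M_V_hat a U M K" and l: "1 \<le> l"
    and [measurable]: "D \<in> borel_measurable M" and D0: "\<And>w. 0 \<le> D w"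
    and D1: "integrable M D" "(\<integral>w. D w \<partial>M) = 1"
    and DK: "\<And>X. X \<in> K \<Longrightarrow> integrable M (\<lambda>w. D w * X w)" "\<And>X. X \<in> K \<Longrightarrow> (\<integral>w. D w * X w \<partial>M) \<le> 0"
    and le: "\<And>w. D w \<le> l * max (dens M Q1 w) (dens M Q2 w)"
  shows "density M (\<lambda>w. ennreal (D w)) \<in> M_V_hat a U M K"
proof -
  let ?Q = "density M (\<lambda>w. ennreal (D w))"
  have "prob_space ?Q"
  proof (rule prob_spaceI)
    have "emeasure ?Q (space ?Q) = (\<integral>\<^sup>+w. ennreal (D w) \<partial>M)"
      by (simp add: emeasure_density cong: nn_integral_cong)
    also have "\<dots> = 1" using nn_integral_eq_integral[OF D1(1)] D0 D1(2) by simp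
    finally show "emeasure ?Q (space ?Q) = 1" .
  qed
  moreover have "integrable ?Q X \<and> integral\<^sup>L ?Q X \<le> 0" if "X \<in> K" for X
    using DK[OF that] K that D0 by (auto simp: integrable_real_density integral_real_density)
  \<comment> \<open>The density of \<open>?Q\<close> agrees with \<open>D\<close> only almost
    everywhere, which the domination lemma permits.\<close>
  moreover have "finite_loss_entropy a U M ?Q"
    by (rule finite_loss_entropy_dominated[OF u Q1 Q2 l])
       (use AE_dens_density[of D] D0 le in \<open>auto elim!: eventually_mono\<close>)
  ultimately show ?thesis
    by (auto simp: M_V_hat_def M1_def intro!: absolutely_continuousI_density)
qed

text \<open>The average of two densities is at most their maximum, so the criterion applies with
  \<open>l = 1\<close>.\<close>

lemma M_V_hat_mixture:
  assumes u: "utility a U U'" and K: "K \<subseteq> borel_measurable M"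
    and Q1: "Q1 \<in> M_V_hat a U M K" and Q2: "Q2 \<in> M_V_hat a U M K"
  obtains Q where "Q \<in> M_V_hat a U M K"
    "\<And>X. X \<in> L_U a U M K \<Longrightarrow> integral\<^sup>L Q X = (integral\<^sup>L Q1 X + integral\<^sup>L Q2 X) / 2"
proof -
  define D where "D w = (dens M Q1 w + dens M Q2 w) / 2" for w
  have [measurable]: "D \<in> borel_measurable M" unfolding D_def by measurable
  have D0: "0 \<le> D w" for w using dens_nonneg[of M Q1 w] dens_nonneg[of M Q2 w] by (simp add: D_def)
  have DX: "integrable M (\<lambda>w. D w * X w)"
    "(\<integral>w. D w * X w \<partial>M) = (integral\<^sup>L Q1 X + integral\<^sup>L Q2 X) / 2"
    if "X \<in> borel_measurable M" "integrable Q1 X" "integrable Q2 X" for X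
  proof -
    have i: "integrable M (\<lambda>w. dens M Q1 w * X w)" "integrable M (\<lambda>w. dens M Q2 w * X w)"
      using integrable_dens_iff(1)[OF Q1 that(1)] integrable_dens_iff(1)[OF Q2 that(1)] that by auto
    have eq: "(\<lambda>w. D w * X w) = (\<lambda>w. (dens M Q1 w * X w + dens M Q2 w * X w) / 2)"
      by (auto simp: D_def algebra_simps add_divide_distrib)
    show "integrable M (\<lambda>w. D w * X w)" unfolding eq using i by simp
    show "(\<integral>w. D w * X w \<partial>M) = (integral\<^sup>L Q1 X + integral\<^sup>L Q2 X) / 2"
      unfolding eq integrable_dens_iff(2)[OF Q1 that(1)] integrable_dens_iff(2)[OF Q2 that(1)]
      using i by simp
  qed
  have "density M (\<lambda>w. ennreal (D w)) \<in> M_V_hat a U M K"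
  proof (rule density_in_M_V_hat[OF u K Q1 Q2 order_refl _ D0])
    show "integrable M D" "(\<integral>w. D w \<partial>M) = 1"
      unfolding D_def using dens_integral[OF Q1] dens_integral[OF Q2] by simp_all
    show "integrable M (\<lambda>w. D w * X w)" "(\<integral>w. D w * X w \<partial>M) \<le> 0" if "X \<in> K" for X
      using DX[of X] M_V_hatD(4,5)[OF Q1 that] M_V_hatD(4,5)[OF Q2 that] K that by auto
    show "D w \<le> 1 * max (dens M Q1 w) (dens M Q2 w)" for w by (simp add: D_def)
  qed measurable
  then show thesis
  proof (rule that)
    fix X assume X: "X \<in> L_U a U M K"
    then have "X \<in> borel_measurable M" "integrable Q1 X" "integrable Q2 X"
      using Q1 Q2 by (auto simp: L_U_def)
    with DX(2)[OF this] D0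
    show "integral\<^sup>L (density M (\<lambda>w. ennreal (D w))) X = (integral\<^sup>L Q1 X + integral\<^sup>L Q2 X) / 2"
      by (simp add: integral_real_density)
  qed
qed

text \<open>The new density is \<open>Z\<close> times that of \<open>Q\<close>, hence at most
  \<open>c\<close> times the latter; the criterion is applied with \<open>Q\<close> in both places.
  This turns a bounded separating density into an admissible measure.\<close>

lemma M_V_hat_tilt:
  assumes u: "utility a U U'" and K: "K \<subseteq> borel_measurable M" and Q: "Q \<in> M_V_hat a U M K"
    and Z: "Z \<in> borel_measurable M" "\<And>w. 0 \<le> Z w" "\<And>w. Z w \<le> c"
    and Z1: "(\<integral>w. Z w \<partial>Q) = 1"
    and ZK: "\<And>X. X \<in> K \<Longrightarrow> (\<integral>w. Z w * X w \<partial>Q) \<le> 0"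
  obtains Q' where "Q' \<in> M_V_hat a U M K"
    "\<And>X :: 'a \<Rightarrow> real. integrable Q X \<Longrightarrow> integral\<^sup>L Q' X = (\<integral>w. Z w * X w \<partial>Q)"
proof -
  note [measurable] = Z(1)
  interpret Q: prob_space Q by (rule M_V_hatD(2)[OF Q])
  note mQ = M_V_hatD(7)[OF Q]
  define D where "D w = Z w * dens M Q w" for w
  have [measurable]: "D \<in> borel_measurable M" unfolding D_def by measurable
  have D0: "0 \<le> D w" for w using Z(2) dens_nonneg[of M Q w] by (simp add: D_def)
  have DX: "integrable M (\<lambda>w. D w * X w)" "(\<integral>w. D w * X w \<partial>M) = (\<integral>w. Z w * X w \<partial>Q)"
    if X: "integrable Q X" for X
  proof -
    have [measurable]: "X \<in> borel_measurable M" using borel_measurable_integrable[OF X] unfolding mQ .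
    have "integrable Q (\<lambda>w. c * X w)" using X by simp
    then have "integrable Q (\<lambda>w. Z w * X w)"
      by (rule Bochner_Integration.integrable_bound)
         (use Z mQ order_trans[OF Z(2,3)] in \<open>auto simp: abs_mult intro!: mult_right_mono\<close>)
    then show "integrable M (\<lambda>w. D w * X w)" "(\<integral>w. D w * X w \<partial>M) = (\<integral>w. Z w * X w \<partial>Q)"
      using integrable_dens_iff[OF Q, of "\<lambda>w. Z w * X w"] by (simp_all add: D_def ac_simps)
  qed
  have "density M (\<lambda>w. ennreal (D w)) \<in> M_V_hat a U M K"
  proof (rule density_in_M_V_hat[OF u K Q Q _ _ D0, of "max c 1"])
    show "integrable M D" "(\<integral>w. D w \<partial>M) = 1" using DX[of "\<lambda>w. 1"] Z1 by simp_all
    show "integrable M (\<lambda>w. D w * X w)" "(\<integral>w. D w * X w \<partial>M) \<le> 0" if "X \<in> K" for X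
      using DX[of X] M_V_hatD(4)[OF Q that] ZK[OF that] by auto
    show "D w \<le> max c 1 * max (dens M Q w) (dens M Q w)" for w
      using dens_nonneg[of M Q w] Z(3)[of w] by (auto simp: D_def intro!: mult_right_mono)
  qed (simp, measurable)
  then show thesis
  proof (rule that)
    fix X :: "'a \<Rightarrow> real" assume X: "integrable Q X"
    have "X \<in> borel_measurable M" using borel_measurable_integrable[OF X] unfolding mQ .
    with DX(2)[OF X] D0 show "integral\<^sup>L (density M (\<lambda>w. ennreal (D w))) X = (\<integral>w. Z w * X w \<partial>Q)"
      by (simp add: integral_real_density)
  qed
qed

text \<open>Each new measure is averaged with the one found so far. Twice the mixture bounds both on
  nonnegative functions, so the constant doubles at each step. Finitely many L1 seminorms are
  thereby controlled by a single one.\<close>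

lemma M_V_hat_dominates_finite:
  assumes u: "utility a U U'" and K: "K \<subseteq> borel_measurable M"
    and ne: "M_V_hat a U M K \<noteq> {}" and F: "finite F" "F \<subseteq> M_V_hat a U M K"
  shows "\<exists>Q\<in>M_V_hat a U M K. \<exists>C\<ge>1. \<forall>R\<in>F. \<forall>X\<in>L_U a U M K.
    (\<forall>w. 0 \<le> X w) \<longrightarrow> integral\<^sup>L R X \<le> C * integral\<^sup>L Q X"
  using F
proof (induction F)
  case empty
  then show ?case using ne by force
next
  case (insert R F)
  then obtain Q C where Q: "Q \<in> M_V_hat a U M K" and C: "1 \<le> (C::real)"
    and le: "\<And>R X. R \<in> F \<Longrightarrow> X \<in> L_U a U M K \<Longrightarrow> (\<forall>w. 0 \<le> X w) \<Longrightarrow> integral\<^sup>L R X \<le> C * integral\<^sup>L Q X"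
    by blast
  obtain Q' where Q': "Q' \<in> M_V_hat a U M K"
    and eq: "\<And>X. X \<in> L_U a U M K \<Longrightarrow> integral\<^sup>L Q' X = (integral\<^sup>L R X + integral\<^sup>L Q X) / 2"
    using M_V_hat_mixture[OF u K, of R Q] insert.prems Q by blast
  have "integral\<^sup>L R' X \<le> (2 * C) * integral\<^sup>L Q' X"
    if R': "R' \<in> insert R F" and X: "X \<in> L_U a U M K" and X0: "\<forall>w. 0 \<le> X w" for R' X
  proof -
    have nn: "0 \<le> integral\<^sup>L R X" "0 \<le> integral\<^sup>L Q X" using X0 by auto
    have "(2 * C) * integral\<^sup>L Q' X = C * integral\<^sup>L R X + C * integral\<^sup>L Q X"
      using eq[OF X] by (simp add: algebra_simps)
    moreover have "integral\<^sup>L R X \<le> C * integral\<^sup>L R X" "0 \<le> C * integral\<^sup>L R X" "0 \<le> C * integral\<^sup>L Q X"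
      using C nn mult_right_mono[OF C nn(1)] by auto
    moreover have "R' = R \<or> integral\<^sup>L R' X \<le> C * integral\<^sup>L Q X" using R' le[OF _ X X0] by blast
    ultimately show ?thesis by auto
  qed
  then show ?case using Q' C by (intro bexI[of _ Q'] exI[of _ "2 * C"]) auto
qed

end

section \<open>The weak closure\<close>

context prob_space
begin

section \<open>Approximants and the degenerate cases\<close>

lemma K_subset_L_U: "K \<subseteq> borel_measurable M \<Longrightarrow> K \<subseteq> L_U a U M K"
  using M_V_hatD(4)[of _ a U M K] by (auto simp: L_U_def)

text \<open>The truncation stays in \<open>L_U\<close>, since both functions do, and differs from
  \<open>X\<close> by exactly the positive part of \<open>X - k\<close>.\<close>

lemma min_in_K_U:
  assumes K: "K \<subseteq> borel_measurable M" and X: "X \<in> L_U a U M K" and k: "k \<in> K"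
  shows "(\<lambda>w. min (X w) (k w)) \<in> K_U a U M K"
  using X subsetD[OF K_subset_L_U[OF K] k, of a U]
  by (auto simp: K_U_def L_U_def intro!: bexI[OF _ k])

lemma convex_cone_rv_zero:
  assumes "convex_cone_rv K" "k \<in> K"
  shows "(\<lambda>w. 0) \<in> K"
proof -
  have "(\<lambda>w. 0 * k w + 0 * k w) \<in> K" using assms order_refl unfolding convex_cone_rv_def by blast
  then show ?thesis by simp
qed

text \<open>\<open>convex_cone_rv\<close> admits the empty set. For empty \<open>K\<close> the
  reference measure itself qualifies: its density is 1, so with threshold 2 the loss-entropy
  integrand vanishes almost everywhere.\<close>

lemma nonempty_if_M_V_hat_empty:
  assumes "M_V_hat a U M K = {}"
  shows "K \<noteq> {}"
proof
  assume K: "K = {}"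
  have "density M (\<lambda>w. ennreal 1) = M" by (simp add: density_1)
  then have "AE w in M. dens M M w = 1" using AE_dens_density[of "\<lambda>w. 1"] by simp
  then have "(\<integral>\<^sup>+w. ennreal (conj_V_plus a U (dens M M w) * indicator {w. dens M M w \<ge> 2} w) \<partial>M)
      = (\<integral>\<^sup>+w. 0 \<partial>M)"
    by (intro nn_integral_cong_AE) (auto elim!: eventually_mono)
  then have "finite_loss_entropy a U M M"
    unfolding finite_loss_entropy_def by (intro exI[of _ 2]) simp
  then have "M \<in> M_V_hat a U M K"
    using K prob_space_axioms by (simp add: M_V_hat_def M1_def absolutely_continuous_def)
  with assms show False by simp
qed

text \<open>The integral is the L1 distance under \<open>Q\<close> from \<open>X\<close> to the
  functions \<open>k - Y\<close> with \<open>Y \<ge> 0\<close>, attained at \<open>Y\<close> equal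
  to the positive part of \<open>k - X\<close>.\<close>

definition approximable :: "ereal \<Rightarrow> (real \<Rightarrow> real) \<Rightarrow> ('a \<Rightarrow> real) set \<Rightarrow> ('a \<Rightarrow> real) set" where
  "approximable a U K = {X \<in> L_U a U M K. \<forall>Q\<in>M_V_hat a U M K. \<forall>e>0. \<exists>k\<in>K.
     (\<integral>w. max (X w - k w) 0 \<partial>Q) < e}"

lemma approximable_imp_L1_closure_K_U:
  assumes K: "K \<subseteq> borel_measurable M" and X: "X \<in> approximable a U K" and Q: "Q \<in> M_V_hat a U M K"
  shows "X \<in> L1_closure Q (K_U a U M K)"
proof -
  have XL: "X \<in> L_U a U M K" using X by (simp add: approximable_def)
  show ?thesis
    unfolding L1_closure_def
  proof (intro CollectI conjI allI impI)
    show "integrable Q X" using XL Q by (simp add: L_U_def)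
    fix e :: real assume "0 < e"
    then obtain k where k: "k \<in> K" "(\<integral>w. max (X w - k w) 0 \<partial>Q) < e"
      using X Q by (auto simp: approximable_def)
    have Z: "(\<lambda>w. min (X w) (k w)) \<in> K_U a U M K" by (rule min_in_K_U[OF K XL k(1)])
    have "(\<lambda>w. \<bar>min (X w) (k w) - X w\<bar>) = (\<lambda>w. max (X w - k w) 0)" by auto
    then show "\<exists>Z\<in>K_U a U M K. integrable Q Z \<and> (\<integral>w. \<bar>Z w - X w\<bar> \<partial>Q) < e"
      using Z k(2) Q by (intro bexI[OF _ Z]) (auto simp: K_U_def L_U_def)
  qed
qed

lemma K_U_subset_K_minus_L1plus:
  assumes Q: "Q \<in> M_V_hat a U M K"
  shows "K_U a U M K \<subseteq> K_minus_L1plus Q K"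
proof
  fix Z assume "Z \<in> K_U a U M K"
  then obtain k where Z: "integrable Q Z" and k: "k \<in> K" "AE w in M. Z w \<le> k w"
    using Q by (auto simp: K_U_def L_U_def)
  have "AE w in Q. Z w \<le> k w"
    using absolutely_continuous_AE[OF M_V_hatD(1,3)[OF Q] k(2)] .
  then have "integrable Q (\<lambda>w. k w - Z w)" "AE w in Q. 0 \<le> k w - Z w"
    using Z M_V_hatD(4)[OF Q k(1)] by auto
  then show "Z \<in> K_minus_L1plus Q K"
    unfolding K_minus_L1plus_def using k(1)
    by (intro CollectI exI[of _ k] exI[of _ "\<lambda>w. k w - Z w"]) simp
qed

text \<open>For \<open>Z = k - Y\<close> with \<open>Y \<ge> 0\<close> one has
  \<open>X - k \<le> X - Z\<close>, so the positive part of \<open>X - k\<close> is at most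
  \<open>|Z - X|\<close>.\<close>

lemma L1_closure_K_minus_imp_approximable:
  assumes X: "X \<in> borel_measurable M"
    and cl: "\<And>Q. Q \<in> M_V_hat a U M K \<Longrightarrow> X \<in> L1_closure Q (K_minus_L1plus Q K)"
  shows "X \<in> approximable a U K"
  unfolding approximable_def
proof (intro CollectI conjI ballI allI impI)
  show "X \<in> L_U a U M K" using X cl by (auto simp: L_U_def L1_closure_def)
  fix Q and e :: real assume Q: "Q \<in> M_V_hat a U M K" and e: "0 < e"
  have iX: "integrable Q X" using cl[OF Q] by (simp add: L1_closure_def)
  from cl[OF Q] e obtain Z where Z: "Z \<in> K_minus_L1plus Q K" "integrable Q Z" "(\<integral>w. \<bar>Z w - X w\<bar> \<partial>Q) < e"
    by (auto simp: L1_closure_def)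
  then obtain k Y where kY: "Z = (\<lambda>w. k w - Y w)" "k \<in> K" "AE w in Q. 0 \<le> Y w"
    by (auto simp: K_minus_L1plus_def)
  have "(\<integral>w. max (X w - k w) 0 \<partial>Q) \<le> (\<integral>w. \<bar>Z w - X w\<bar> \<partial>Q)"
  proof (rule integral_mono_AE)
    show "AE w in Q. max (X w - k w) 0 \<le> \<bar>Z w - X w\<bar>"
      using kY(3) by eventually_elim (auto simp: kY(1))
  qed (use iX Z(2) M_V_hatD(4)[OF Q kY(2)] in auto)
  with Z(3) kY(2) show "\<exists>k\<in>K. (\<integral>w. max (X w - k w) 0 \<partial>Q) < e" by force
qed

text \<open>The empty linear combination is the zero functional; with \<open>G = UNIV\<close> its
  subbasic set is all of \<open>L_U\<close>.\<close>

lemma topspace_weak_top: "topspace (weak_top a U M K) = L_U a U M K"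
proof -
  have "(\<lambda>w. 0) \<in> L_V_plus a U M K" unfolding L_V_plus_def by (rule CollectI, rule exI[of _ 0]) simp
  then have "{X \<in> L_U a U M K. (\<integral>w. X w * (\<lambda>w. 0) w \<partial>M) \<in> UNIV}
      \<in> {{X \<in> L_U a U M K. (\<integral>w. X w * Y w \<partial>M) \<in> G} | Y G. Y \<in> L_V_plus a U M K \<and> open G}"
    by blast
  then show ?thesis unfolding weak_top_def topology_generated_by_topspace by auto
qed

section \<open>Weak neighbourhoods and the two inclusions\<close>

lemma dens_in_L_V_plus: "Q \<in> M_V_hat a U M K \<Longrightarrow> dens M Q \<in> L_V_plus a U M K"
  unfolding L_V_plus_def
  by (rule CollectI, rule exI[of _ 1], rule exI[of _ "\<lambda>_. 1"], rule exI[of _ "\<lambda>_. Q"]) simp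

lemma pairing_L_V_plus:
  assumes X: "X \<in> L_U a U M K" and Qs: "\<forall>i<n. Qs i \<in> M_V_hat a U M K"
  shows "(\<integral>w. X w * (\<Sum>i<n. c i * dens M (Qs i) w) \<partial>M) = (\<Sum>i<n. c i * integral\<^sup>L (Qs i) X)"
proof -
  have "X \<in> borel_measurable M" using X by (simp add: L_U_def)
  note * = integrable_dens_iff[OF _ this]
  have i: "integrable M (\<lambda>w. dens M (Qs i) w * X w)" if "i < n" for i
    using *(1)[of "Qs i" a U K] X Qs that by (auto simp: L_U_def)
  have "(\<lambda>w. X w * (\<Sum>i<n. c i * dens M (Qs i) w)) = (\<lambda>w. \<Sum>i<n. c i * (dens M (Qs i) w * X w))"
    by (auto simp: sum_distrib_left ac_simps)
  then have "(\<integral>w. X w * (\<Sum>i<n. c i * dens M (Qs i) w) \<partial>M) = (\<Sum>i<n. \<integral>w. c i * (dens M (Qs i) w * X w) \<partial>M)"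
    using i by (simp add: Bochner_Integration.integral_sum)
  also have "\<dots> = (\<Sum>i<n. c i * integral\<^sup>L (Qs i) X)"
    by (intro sum.cong refl) (use *(2) Qs in auto)
  finally show ?thesis .
qed

text \<open>Weakly open sets contain L1 balls for finitely many measures, because a functional in
  \<open>L_V_plus\<close> is a finite combination of expectations. The induction follows the
  generation of the topology.\<close>

lemma weak_top_neighbourhood:
  assumes T: "openin (weak_top a U M K) T" and X: "X \<in> T"
  shows "\<exists>F e. finite F \<and> F \<subseteq> M_V_hat a U M K \<and> 0 < e \<and>
    (\<forall>W\<in>L_U a U M K. (\<forall>Q\<in>F. (\<integral>w. \<bar>W w - X w\<bar> \<partial>Q) < e) \<longrightarrow> W \<in> T)"
proof -
  have XL: "X \<in> L_U a U M K"
    using openin_subset[OF T] X topspace_weak_top by blast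
  have "generate_topology_on
     {{X \<in> L_U a U M K. (\<integral>w. X w * Y w \<partial>M) \<in> G} | Y G. Y \<in> L_V_plus a U M K \<and> open G} T"
    using T unfolding weak_top_def openin_topology_generated_by_iff .
  then show ?thesis using X
  proof (induction T rule: generate_topology_on.induct)
    case Empty
    then show ?case by simp
  next
    case (Int T1 T2)
    then obtain F1 e1 F2 e2 where
      "finite F1" "F1 \<subseteq> M_V_hat a U M K" "0 < e1"
      "\<forall>W\<in>L_U a U M K. (\<forall>Q\<in>F1. (\<integral>w. \<bar>W w - X w\<bar> \<partial>Q) < e1) \<longrightarrow> W \<in> T1"
      "finite F2" "F2 \<subseteq> M_V_hat a U M K" "0 < e2"
      "\<forall>W\<in>L_U a U M K. (\<forall>Q\<in>F2. (\<integral>w. \<bar>W w - X w\<bar> \<partial>Q) < e2) \<longrightarrow> W \<in> T2"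
      by blast
    then show ?case by (intro exI[of _ "F1 \<union> F2"] exI[of _ "min e1 e2"]) auto
  next
    case (UN \<T>)
    then obtain T where T: "T \<in> \<T>" "X \<in> T" by blast
    from UN.IH[OF this] T(1) show ?case by blast
  next
    case (Basis T)
    then obtain Y G where T: "T = {X \<in> L_U a U M K. (\<integral>w. X w * Y w \<partial>M) \<in> G}"
      and Y: "Y \<in> L_V_plus a U M K" and G: "open G" by blast
    from Y obtain n :: nat and c Qs where Ye: "Y = (\<lambda>w. \<Sum>i<n. c i * dens M (Qs i) w)"
      and Qs: "\<forall>i<n. Qs i \<in> M_V_hat a U M K"
      by (auto simp: L_V_plus_def)
    define s where "s = (\<Sum>i<n. c i * integral\<^sup>L (Qs i) X)"
    have "s \<in> G" using Basis.prems pairing_L_V_plus[OF XL Qs, of c] by (simp add: T Ye s_def)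
    then obtain d where d: "0 < d" "ball s d \<subseteq> G" using G open_contains_ball by blast
    define C where "C = (\<Sum>i<n. \<bar>c i\<bar>)"
    have C0: "0 \<le> C" by (simp add: C_def sum_nonneg)
    \<comment> \<open>The summand 1 covers \<open>C = 0\<close> and makes \<open>C * e < d\<close>
      strict.\<close>
    define e where "e = d / (C + 1)"
    have e: "0 < e" "C * e < d" using d C0 by (auto simp: e_def field_simps)
    have "W \<in> T" if W: "W \<in> L_U a U M K" and close: "\<forall>Q\<in>Qs ` {..<n}. (\<integral>w. \<bar>W w - X w\<bar> \<partial>Q) < e" for W
    proof -
      have "\<bar>s - (\<Sum>i<n. c i * integral\<^sup>L (Qs i) W)\<bar> = \<bar>\<Sum>i<n. c i * (integral\<^sup>L (Qs i) X - integral\<^sup>L (Qs i) W)\<bar>"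
        by (simp add: s_def sum_subtractf right_diff_distrib)
      also have "\<dots> \<le> (\<Sum>i<n. \<bar>c i\<bar> * e)"
      proof (rule order_trans[OF sum_abs sum_mono])
        fix i assume i: "i \<in> {..<n}"
        then have iq: "integrable (Qs i) X" "integrable (Qs i) W" using XL W Qs by (auto simp: L_U_def)
        have "\<bar>integral\<^sup>L (Qs i) X - integral\<^sup>L (Qs i) W\<bar> = \<bar>\<integral>w. W w - X w \<partial>Qs i\<bar>"
          using iq by (simp add: abs_minus_commute)
        also have "\<dots> \<le> (\<integral>w. \<bar>W w - X w\<bar> \<partial>Qs i)" by (rule integral_abs_bound)
        also have "\<dots> \<le> e" using close i by (auto intro: less_imp_le)
        finally show "\<bar>c i * (integral\<^sup>L (Qs i) X - integral\<^sup>L (Qs i) W)\<bar> \<le> \<bar>c i\<bar> * e"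
          by (simp add: abs_mult mult_left_mono)
      qed
      also have "\<dots> = C * e" by (simp add: C_def sum_distrib_right)
      also have "\<dots> < d" by (rule e)
      finally have "(\<Sum>i<n. c i * integral\<^sup>L (Qs i) W) \<in> ball s d" by (simp add: dist_real_def)
      then show ?thesis using d W pairing_L_V_plus[OF W Qs, of c] by (auto simp: T Ye)
    qed
    then show ?case using e Qs by (intro exI[of _ "Qs ` {..<n}"] exI[of _ e]) auto
  qed
qed

text \<open>A weak neighbourhood tests finitely many measures; one measure dominates them with a
  constant \<open>C\<close>, so an approximation within \<open>e / C\<close> under that measure
  suffices.\<close>

lemma approximable_subset_C_U:
  assumes u: "utility a U U'" and K: "K \<subseteq> borel_measurable M"
  shows "approximable a U K \<subseteq> C_U a U M K"
proof
  fix X assume X: "X \<in> approximable a U K"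
  then have XL: "X \<in> L_U a U M K" by (simp add: approximable_def)
  have "\<exists>W\<in>K_U a U M K. W \<in> T" if T: "openin (weak_top a U M K) T" and XT: "X \<in> T" for T
  proof -
    obtain F e where F: "finite F" "F \<subseteq> M_V_hat a U M K" and e: "0 < e"
      and nb: "\<And>W. W \<in> L_U a U M K \<Longrightarrow> (\<forall>Q\<in>F. (\<integral>w. \<bar>W w - X w\<bar> \<partial>Q) < e) \<Longrightarrow> W \<in> T"
      using weak_top_neighbourhood[OF T XT] by auto
    show ?thesis
    proof (cases "M_V_hat a U M K = {}")
      \<comment> \<open>Without measures \<open>F\<close> is empty, so every element of
        \<open>L_U\<close> lies in \<open>T\<close>; only an element of \<open>K_U\<close> has to be
        exhibited.\<close>
      case True
      then obtain k where "k \<in> K" using nonempty_if_M_V_hat_empty by blast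
      then have W: "(\<lambda>w. min (X w) (k w)) \<in> K_U a U M K" using min_in_K_U[OF K XL] by simp
      moreover have "(\<lambda>w. min (X w) (k w)) \<in> T"
        using nb W F True by (auto simp: K_U_def)
      ultimately show ?thesis by blast
    next
      case False
      obtain Q C where Q: "Q \<in> M_V_hat a U M K" and C: "1 \<le> (C::real)"
        and le: "\<And>R Y. R \<in> F \<Longrightarrow> Y \<in> L_U a U M K \<Longrightarrow> (\<forall>w. 0 \<le> Y w) \<Longrightarrow> integral\<^sup>L R Y \<le> C * integral\<^sup>L Q Y"
        using M_V_hat_dominates_finite[OF u K False F] by blast
      have "X \<in> L1_closure Q (K_U a U M K)" by (rule approximable_imp_L1_closure_K_U[OF K X Q])
      moreover have "0 < e / C" using e C by simp
      ultimately obtain W where W: "W \<in> K_U a U M K" "(\<integral>w. \<bar>W w - X w\<bar> \<partial>Q) < e / C"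
        unfolding L1_closure_def by blast
      have WL: "W \<in> L_U a U M K" using W by (simp add: K_U_def)
      have "(\<lambda>w. \<bar>W w - X w\<bar>) \<in> L_U a U M K" using WL XL by (auto simp: L_U_def)
      then have "(\<integral>w. \<bar>W w - X w\<bar> \<partial>R) < e" if "R \<in> F" for R
        using le[OF that, of "\<lambda>w. \<bar>W w - X w\<bar>"] W(2) C by (simp add: field_simps)
      then show ?thesis using nb[OF WL] W(1) by blast
    qed
  qed
  then show "X \<in> C_U a U M K"
    unfolding C_U_def in_closure_of topspace_weak_top using XL by blast
qed

lemma C_U_subset_approximable:
  assumes u: "utility a U U'" and K: "K \<subseteq> borel_measurable M" and cone: "convex_cone_rv K"
  shows "C_U a U M K \<subseteq> approximable a U K"
proof
  fix X assume XC: "X \<in> C_U a U M K"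
  then have XL: "X \<in> L_U a U M K"
    and meet: "\<And>T. openin (weak_top a U M K) T \<Longrightarrow> X \<in> T \<Longrightarrow> \<exists>W\<in>K_U a U M K. W \<in> T"
    unfolding C_U_def in_closure_of topspace_weak_top by blast+
  \<comment> \<open>The whole space is a neighbourhood of \<open>X\<close> and meets
    \<open>K_U\<close>, so \<open>K\<close> is nonempty and, as a cone, contains 0.\<close>
  obtain k0 where k0: "k0 \<in> K"
    using meet[OF openin_topspace] XL unfolding topspace_weak_top K_U_def by blast
  have zero: "(\<lambda>w. 0) \<in> K" by (rule convex_cone_rv_zero[OF cone k0])
  have Kadd: "(\<lambda>w. k w + k' w) \<in> K" if "k \<in> K" "k' \<in> K" for k k'
  proof -
    have "(\<lambda>w. 1 * k w + 1 * k' w) \<in> K" using cone that zero_le_one unfolding convex_cone_rv_def by blast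
    then show ?thesis by simp
  qed
  have Kscale: "(\<lambda>w. t * k w) \<in> K" if "k \<in> K" "0 < t" for k t
  proof -
    have "(\<lambda>w. t * k w + 0 * k w) \<in> K"
      using cone that less_imp_le[OF that(2)] order_refl unfolding convex_cone_rv_def by blast
    then show ?thesis by simp
  qed
  show "X \<in> approximable a U K"
  proof (rule ccontr)
    assume "X \<notin> approximable a U K"
    then obtain Q e where Q: "Q \<in> M_V_hat a U M K" and e: "0 < e"
      and far: "\<And>k. k \<in> K \<Longrightarrow> e \<le> (\<integral>w. max (X w - k w) 0 \<partial>Q)"
      using XL by (force simp: approximable_def not_less)
    interpret Q: prob_space Q by (rule M_V_hatD(2)[OF Q])
    note Kint = M_V_hatD(4)[OF Q]
    define S where "S = {Y :: 'a \<Rightarrow> real. integrable Q Y}"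
    define d where "d Y k = (\<integral>w. max (Y w - k w) 0 \<partial>Q)" for Y k :: "'a \<Rightarrow> real"
    \<comment> \<open>The L1 distance under \<open>Q\<close> from \<open>Y\<close> to
      \<open>K\<close> minus the nonnegative functions. It is sublinear since \<open>K\<close> is a
      convex cone, nonpositive on \<open>K\<close>, at most \<open>E_Q |Y|\<close> since
      \<open>0 \<in> K\<close>, and at least \<open>e\<close> at \<open>X\<close>.\<close>
    define p where "p Y = (INF k\<in>K. d Y k)" for Y
    have iX: "integrable Q X" using XL Q by (simp add: L_U_def)
    have S: "function_space S" by (auto simp: function_space_def S_def)
    have imax: "integrable Q (\<lambda>w. max (Y w - k w) 0)" if "Y \<in> S" "k \<in> K" for Y k
      using that Kint by (auto simp: S_def)
    have p_le: "p Y \<le> d Y k" if "k \<in> K" for Y k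
      unfolding p_def by (rule cINF_lower[OF bdd_belowI2[of _ 0] that]) (simp add: d_def)
    have p_great: "c \<le> p Y" if "\<And>k. k \<in> K \<Longrightarrow> c \<le> d Y k" for c Y
      unfolding p_def by (rule cINF_greatest) (use k0 that in auto)
    have p: "sublinear_on S p"
      unfolding sublinear_on_def
    proof (intro conjI ballI allI impI)
      fix x y assume x: "x \<in> S" and y: "y \<in> S"
      have *: "p (\<lambda>w. x w + y w) \<le> d x k + d y k'" if "k \<in> K" "k' \<in> K" for k k'
      proof -
        have "p (\<lambda>w. x w + y w) \<le> d (\<lambda>w. x w + y w) (\<lambda>w. k w + k' w)" by (rule p_le[OF Kadd[OF that]])
        also have "\<dots> \<le> (\<integral>w. max (x w - k w) 0 + max (y w - k' w) 0 \<partial>Q)"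
          unfolding d_def
          using imax[OF x that(1)] imax[OF y that(2)]
            imax[OF function_spaceD(2)[OF S x y] Kadd[OF that]]
          by (intro integral_mono) auto
        also have "\<dots> = d x k + d y k'" unfolding d_def
          using imax[OF x that(1)] imax[OF y that(2)] by simp
        finally show ?thesis .
      qed
      have "p (\<lambda>w. x w + y w) - d y k' \<le> p x" if "k' \<in> K" for k'
        by (rule p_great) (use *[OF _ that] in force)
      then have "p (\<lambda>w. x w + y w) - p x \<le> p y" by (intro p_great) force
      then show "p (\<lambda>w. x w + y w) \<le> p x + p y" by simp
    next
      fix x and t :: real assume x: "x \<in> S" and t: "0 < t"
      have "p (\<lambda>w. t * x w) / t \<le> p x"
      proof (rule p_great)
        fix k assume k: "k \<in> K"
        have "p (\<lambda>w. t * x w) \<le> d (\<lambda>w. t * x w) (\<lambda>w. t * k w)" by (rule p_le[OF Kscale[OF k t]])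
        also have "\<dots> = (\<integral>w. t * max (x w - k w) 0 \<partial>Q)"
        proof -
          have "max (t * r - t * s) 0 = t * max (r - s) 0" for r s :: real
            using t by (simp add: max_mult_distrib_left right_diff_distrib)
          then show ?thesis by (simp add: d_def)
        qed
        also have "\<dots> = t * d x k" by (simp add: d_def)
        finally show "p (\<lambda>w. t * x w) / t \<le> d x k" using t by (simp add: field_simps)
      qed
      then show "p (\<lambda>w. t * x w) \<le> t * p x" using t by (simp add: field_simps)
    qed
    have "X \<in> S" using iX by (simp add: S_def)
    from hahn_banach_function_space[OF S p this] obtain f where
      f: "\<forall>x\<in>S. f x \<le> p x" "f X = p X" "\<forall>x\<in>S. \<forall>y\<in>S. f (\<lambda>w. x w + y w) = f x + f y"
        "\<forall>x\<in>S. \<forall>t. f (\<lambda>w. t * x w) = t * f x"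
      by (elim exE conjE) (rule that)
    note fp = f(1)[rule_format] and fX = f(2) and fadd = f(3)[rule_format] and fscale = f(4)[rule_format]
    have fX_pos: "0 < f X" unfolding fX using e p_great[of e X] far by (force simp: d_def)
    have fK: "f k \<le> 0" if "k \<in> K" for k
      using fp[of k] p_le[OF that, of k] Kint[OF that] by (simp add: S_def d_def)
    have bound: "f Y \<le> (\<integral>w. \<bar>Y w\<bar> \<partial>Q)" if "integrable Q Y" for Y
    proof -
      have "f Y \<le> d Y (\<lambda>w. 0)" using fp[of Y] p_le[OF zero, of Y] that by (simp add: S_def)
      also have "\<dots> \<le> (\<integral>w. \<bar>Y w\<bar> \<partial>Q)" unfolding d_def using that by (intro integral_mono) auto
      finally show ?thesis .
    qed
    \<comment> \<open>The positive part of \<open>-Y\<close> vanishes, so comparison with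
      \<open>0 \<in> K\<close> gives \<open>f (-Y) \<le> 0\<close>.\<close>
    have pos: "0 \<le> f Y" if "integrable Q Y" "\<And>w. 0 \<le> Y w" for Y
    proof -
      have "f (\<lambda>w. (-1) * Y w) \<le> d (\<lambda>w. (-1) * Y w) (\<lambda>w. 0)"
        using fp[of "\<lambda>w. (-1) * Y w"] p_le[OF zero, of "\<lambda>w. (-1) * Y w"] that by (simp add: S_def)
      also have "\<dots> = 0" using that(2) by (simp add: d_def max_absorb2)
      finally show ?thesis using fscale[of Y "-1"] that by (simp add: S_def)
    qed
    obtain Z where Z: "Z \<in> borel_measurable Q" "\<And>w. 0 \<le> Z w" "\<And>w. Z w \<le> (1::real)"
      and fZ: "\<And>Y. integrable Q Y \<Longrightarrow> f Y = (\<integral>w. Z w * Y w \<partial>Q)"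
    proof (rule positive_functional_L1_representation[OF M_V_hatD(2)[OF Q], of f])
    qed (use fadd fscale bound pos in \<open>auto simp: S_def\<close>)
    \<comment> \<open>Normalising constant that makes \<open>Z / c\<close> a probability density
      under \<open>Q\<close>. It is nonzero because \<open>Z = 0\<close> almost everywhere would
      give \<open>f X = 0\<close>.\<close>
    define c where "c = (\<integral>w. Z w \<partial>Q)"
    have iZ: "integrable Q Z" by (rule Q.integrable_const_bound[of _ 1]) (use Z in auto)
    have "c \<noteq> 0"
    proof
      assume "c = 0"
      then have "AE w in Q. Z w = 0"
        using integral_nonneg_eq_0_iff_AE[OF iZ] Z(2) by (simp add: c_def)
      then have "(\<integral>w. Z w * X w \<partial>Q) = 0"
        by (intro integral_eq_zero_AE) (auto elim!: eventually_mono)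
      with fZ[OF iX] fX_pos show False by simp
    qed
    moreover have "0 \<le> c" using Z(2) by (simp add: c_def)
    ultimately have c: "0 < c" by simp
    have eq: "(\<integral>w. Z w / c * Y w \<partial>Q) = f Y / c" if "integrable Q Y" for Y
      using fZ[OF that] by simp
    obtain Q' where Q': "Q' \<in> M_V_hat a U M K"
      and EQ': "\<And>Y :: 'a \<Rightarrow> real. integrable Q Y \<Longrightarrow> integral\<^sup>L Q' Y = (\<integral>w. Z w / c * Y w \<partial>Q)"
    proof (rule M_V_hat_tilt[OF u K Q, of "\<lambda>w. Z w / c" "1 / c"])
      show "(\<lambda>w. Z w / c) \<in> borel_measurable M" using Z(1) unfolding M_V_hatD(7)[OF Q] by simp
      show "0 \<le> Z w / c" "Z w / c \<le> 1 / c" for w using Z(2,3) c by (auto simp: divide_right_mono)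
      show "(\<integral>w. Z w / c \<partial>Q) = 1" using c by (simp add: c_def)
      show "(\<integral>w. Z w / c * k w \<partial>Q) \<le> 0" if "k \<in> K" for k
        using eq[OF Kint[OF that]] fK[OF that] c by (simp add: divide_nonpos_pos)
    qed blast
    \<comment> \<open>The open half-space where the expectation under \<open>Q'\<close> is positive
      contains \<open>X\<close>. It misses \<open>K_U\<close>, whose elements lie below some
      \<open>k\<close> with nonpositive expectation.\<close>
    define T where "T = {W \<in> L_U a U M K. (\<integral>w. W w * dens M Q' w \<partial>M) \<in> {0<..}}"
    have T_iff: "W \<in> T \<longleftrightarrow> 0 < integral\<^sup>L Q' W" if "W \<in> L_U a U M K" for W
      using integrable_dens_iff(2)[OF Q', of W] that by (simp add: T_def L_U_def mult.commute)
    have "openin (weak_top a U M K) T"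
      unfolding weak_top_def T_def
      by (rule topology_generated_by_Basis) (use dens_in_L_V_plus[OF Q'] open_greaterThan in blast)
    moreover have "X \<in> T" unfolding T_iff[OF XL] EQ'[OF iX] eq[OF iX] using fX_pos c by simp
    ultimately obtain W where W: "W \<in> K_U a U M K" "W \<in> T" using meet by blast
    then obtain k where k: "k \<in> K" "AE w in M. W w \<le> k w" and WL: "W \<in> L_U a U M K"
      by (auto simp: K_U_def)
    have "AE w in Q'. W w \<le> k w"
      using absolutely_continuous_AE[OF M_V_hatD(1,3)[OF Q'] k(2)] .
    then have "integral\<^sup>L Q' W \<le> integral\<^sup>L Q' k"
      using WL Q' M_V_hatD(4)[OF Q' k(1)] by (intro integral_mono_AE) (auto simp: L_U_def)
    then show False using M_V_hatD(5)[OF Q' k(1)] W(2) T_iff[OF WL] by simp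
  qed
qed

end

lemma L1_closure_mono: "A \<subseteq> B \<Longrightarrow> L1_closure Q A \<subseteq> L1_closure Q B"
  unfolding L1_closure_def by blast

text \<open>Intersecting inside the measurable functions gives meaning to an empty index set: both
  right-hand sides and \<open>C_U\<close> then consist of all measurable functions.\<close>

theorem theorem6p1:
  fixes P :: "'w measure" and K :: "('w \<Rightarrow> real) set"
    and a :: ereal and U U' :: "real \<Rightarrow> real"
  assumes "prob_space P"
    and "K \<subseteq> borel_measurable P"
    and "convex_cone_rv K"
    and "utility a U U'"
  shows "C_U a U P K =
           {X \<in> borel_measurable P. \<forall>Q\<in>M_V_hat a U P K. X \<in> L1_closure Q (K_U a U P K)}
       \<and> C_U a U P K =
           {X \<in> borel_measurable P. \<forall>Q\<in>M_V_hat a U P K. X \<in> L1_closure Q (K_minus_L1plus Q K)}"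
    (is "_ = ?R1 \<and> _ = ?R2")
proof -
  interpret prob_space P by fact
  have eq: "C_U a U P K = approximable a U K"
    using C_U_subset_approximable approximable_subset_C_U assms by blast
  \<comment> \<open>The inclusions \<open>1\<close>, \<open>2\<close> and \<open>3\<close> form a
    cycle, so all sets coincide.\<close>
  have 1: "approximable a U K \<subseteq> ?R1"
    using approximable_imp_L1_closure_K_U[OF assms(2)] by (auto simp: approximable_def L_U_def)
  have 2: "?R1 \<subseteq> ?R2"
    using L1_closure_mono[OF K_U_subset_K_minus_L1plus] by blast
  have 3: "?R2 \<subseteq> approximable a U K"
    using L1_closure_K_minus_imp_approximable by blast
  show ?thesis
    unfolding eq by (intro conjI equalityI 1 3 order_trans[OF 1 2] order_trans[OF 2 3])
qed

end
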